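(* Let $s,t\in\mathbb N$ be relatively prime, let $\sigma$ be an $s$-core and $\tau$ a $t$-core, and for $k\in\mathbb N$ let $$N_{\sigma,\tau}(k)=\#\{\lambda\in\mathcal C_{st}\ :\ \mathrm{core}_s\lambda=\sigma,\ \mathrm{core}_t\lambda=\tau,\ \ell(\lambda)\le k\}.$$ Then there is a quasipolynomial $Q_{\sigma,\tau}(k)$ of degree $(s-1)(t-1)$ and period $st$ such that $N_{\sigma,\tau}(k)=Q_{\sigma,\tau}(k)$ for all sufficiently large integers $k$. The leading coefficient of $Q_{\sigma,\tau}$ is a positive number $V_{s,t}$ depending only on $s$ and $t$, namely the relative volume of the transportation polytope of real $t\times s$ matrices with nonnegative entries, all row sums equal to $s$ and all column sums equal to $t$.
   Context: A partition $\lambda=(a_1,\dots,a_\ell)$ is a weakly decreasing finite sequence of positive integers; $\ell(\lambda)=\ell$ is its length (the empty partition has length $0$). For $t\in\mathbb N$, a $t$-core is a partition whose Young diagram contains no hook of size (hooklength) $t$; $\mathcal C_t$ denotes the set of $t$-cores. For a partition $\lambda$, $\mathrm{core}_t\lambda$ is the $t$-core of $\lambda$: the partition obtained by successively removing rim hooks (border strips) of size $t$ from the Young diagram of $\lambda$ until none remain (the result is independent of the choices). A function $Q:\mathbb N\to\mathbb Q$ is a quasipolynomial of period $p\in\mathbb N$ if for each $0\le i<p$ the function $n\mapsto Q(i+np)$ ($n=0,1,2,\dots$) is a polynomial $P_i(n)$; its degree is the maximum of the degrees of the $P_i$. "The leading coefficient of $Q$ is $c$" means that each $P_i$ (for the stated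 period) has degree equal to the degree of $Q$ and leading coefficient $c$. Relative volume: if $\mathcal P\subset\mathbb R^n$ is a polytope with integer vertices and dimension $d$ (dimension of its affine span), choose an affine isomorphism $T$ from the affine span of $\mathcal P$ onto $\mathbb R^d$ mapping the integer points of the affine span bijectively onto $\mathbb Z^d$; the relative volume of $\mathcal P$ is the ($d$-dimensional) volume of $T(\mathcal P)$, which is independent of $T$. *)

theory Defs
  imports "HOL-Analysis.Analysis" "HOL-Computational_Algebra.Polynomial"
begin

definition is_partition :: "nat list \<Rightarrow> bool" where
  "is_partition p \<longleftrightarrow> sorted_wrt (\<ge>) p \<and> (\<forall>a\<in>set p. 0 < a)"

definition cells :: "nat list \<Rightarrow> (nat \<times> nat) set" where
  "cells p = {(i, j). i < length p \<and> j < p ! i}"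

definition hook_length :: "nat list \<Rightarrow> nat \<Rightarrow> nat \<Rightarrow> nat" where
  "hook_length p i j = (p ! i - j - 1) + card {k. i < k \<and> k < length p \<and> j < p ! k} + 1"

definition is_core :: "nat \<Rightarrow> nat list \<Rightarrow> bool" where
  "is_core t p \<longleftrightarrow> is_partition p \<and> (\<forall>(i, j)\<in>cells p. hook_length p i j \<noteq> t)"

definition cell_adj :: "nat \<times> nat \<Rightarrow> nat \<times> nat \<Rightarrow> bool" where
  "cell_adj a b \<longleftrightarrow>
     (fst a = fst b \<and> (snd b = snd a + 1 \<or> snd a = snd b + 1)) \<or>
     (snd a = snd b \<and> (fst b = fst a + 1 \<or> fst a = fst b + 1))"

definition cells_connected :: "(nat \<times> nat) set \<Rightarrow> bool" where
  "cells_connected A \<longleftrightarrow>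
     (\<forall>x\<in>A. \<forall>y\<in>A. (\<lambda>a b. a \<in> A \<and> b \<in> A \<and> cell_adj a b)\<^sup>*\<^sup>* x y)"

definition no_2x2 :: "(nat \<times> nat) set \<Rightarrow> bool" where
  "no_2x2 A \<longleftrightarrow> \<not> (\<exists>i j. {(i, j), (i + 1, j), (i, j + 1), (i + 1, j + 1)} \<subseteq> A)"

definition rim_hook_removal :: "nat \<Rightarrow> nat list \<Rightarrow> nat list \<Rightarrow> bool" where
  "rim_hook_removal t p q \<longleftrightarrow> is_partition p \<and> is_partition q \<and> cells q \<subseteq> cells p \<and>
     card (cells p - cells q) = t \<and> cells (p) - cells q \<noteq> {} \<and>
     cells_connected (cells p - cells q) \<and> no_2x2 (cells p - cells q)"

definition core :: "nat \<Rightarrow> nat list \<Rightarrow> nat list" where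
  "core t p = (THE q. (rim_hook_removal t)\<^sup>*\<^sup>* p q \<and> is_core t q)"

definition N_count :: "nat \<Rightarrow> nat \<Rightarrow> nat list \<Rightarrow> nat list \<Rightarrow> nat \<Rightarrow> nat" where
  "N_count s t \<sigma> \<tau> k = card {p. is_core (s * t) p \<and> core s p = \<sigma> \<and> core t p = \<tau> \<and> length p \<le> k}"

definition aff_span :: "(nat \<Rightarrow> nat \<Rightarrow> real) set \<Rightarrow> (nat \<Rightarrow> nat \<Rightarrow> real) set" where
  "aff_span P = {x. \<exists>S u. finite S \<and> S \<subseteq> P \<and> S \<noteq> {} \<and> sum u S = 1 \<and>
                        x = (\<lambda>i j. \<Sum>p\<in>S. u p * p i j)}"

definition int_matrix :: "(nat \<Rightarrow> nat \<Rightarrow> real) \<Rightarrow> bool" where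
  "int_matrix M \<longleftrightarrow> (\<forall>i j. M i j \<in> \<int>)"

text \<open>R^d is modelled as {f :: nat => real. f i = 0 for i >= d}.\<close>
definition lattice_chart :: "(nat \<Rightarrow> nat \<Rightarrow> real) set \<Rightarrow> nat \<Rightarrow> ((nat \<Rightarrow> nat \<Rightarrow> real) \<Rightarrow> (nat \<Rightarrow> real)) \<Rightarrow> bool" where
  "lattice_chart P d T \<longleftrightarrow>
     bij_betw T (aff_span P) {f. \<forall>i\<ge>d. f i = 0} \<and>
     (\<forall>x\<in>aff_span P. \<forall>y\<in>aff_span P. \<forall>u::real.
        T (\<lambda>i j. (1 - u) * x i j + u * y i j) = (\<lambda>k. (1 - u) * T x k + u * T y k)) \<and>
     bij_betw T (aff_span P \<inter> {M. int_matrix M}) {f. (\<forall>i\<ge>d. f i = 0) \<and> (\<forall>i. f i \<in> \<int>)}"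

definition rel_volume :: "(nat \<Rightarrow> nat \<Rightarrow> real) set \<Rightarrow> real" where
  "rel_volume P = (SOME v. \<exists>d T. lattice_chart P d T \<and>
      v = measure (PiM {..<d} (\<lambda>_. lborel)) ((\<lambda>f. restrict f {..<d}) ` T ` P))"

definition transport_polytope :: "nat \<Rightarrow> nat \<Rightarrow> (nat \<Rightarrow> nat \<Rightarrow> real) set" where
  "transport_polytope s t = {M. (\<forall>i j. (t \<le> i \<or> s \<le> j) \<longrightarrow> M i j = 0) \<and>
      (\<forall>i<t. \<forall>j<s. 0 \<le> M i j) \<and>
      (\<forall>i<t. (\<Sum>j<s. M i j) = real s) \<and>
      (\<forall>j<s. (\<Sum>i<t. M i j) = real t)}"

end

theory Submission
  imports Defs "HOL-Number_Theory.Cong"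
begin

text \<open>
  A partition with at most \<open>k\<close> parts is encoded by its \<open>k\<close> beta numbers. Removing a rim hook of size
  \<open>t\<close> replaces one beta number \<open>x\<close> by \<open>x - t\<close>, so the \<open>t\<close>-core is determined by the numbers of beta
  numbers in the residue classes modulo \<open>t\<close>, and an \<open>st\<close>-core with at most \<open>k\<close> parts is determined by
  the numbers of its beta numbers in the classes modulo \<open>st\<close>. By the Chinese remainder theorem these
  numbers form a \<open>t \<times> s\<close> table of nonnegative integers; prescribing the two cores prescribes its
  margins, and passing from \<open>k\<close> to \<open>k + st\<close> adds \<open>s\<close> to every row sum and \<open>t\<close> to every column sum.

  Let \<open>F\<^sub>A(v)\<close> be the number of tables with margins \<open>v\<close> supported on a set \<open>A\<close> of cells, and let \<open>w\<close> be the
  margin vector above. For a cell \<open>e\<close> in \<open>A\<close> with margin vector \<open>m\<^sub>e\<close>, the difference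
  \<open>F\<^sub>A(v) - F\<^sub>A(v - m\<^sub>e)\<close> counts the tables supported on \<open>A - {e}\<close>. By induction on \<open>A\<close> the vectors \<open>h\<close>
  for which \<open>F\<^sub>A(v + h + nw) - F\<^sub>A(v + nw)\<close> is eventually polynomial in \<open>n\<close> form a group containing
  all \<open>m\<^sub>e\<close>. If \<open>A\<close> is a connected bipartite graph, this group contains \<open>w\<close>, and summation shows that
  \<open>F\<^sub>A(v + nw)\<close> is eventually polynomial. Otherwise \<open>A\<close> splits along a cut, across which the margins
  cannot balance for large \<open>n\<close> because \<open>s\<close> and \<open>t\<close> are coprime, so \<open>F\<^sub>A(v + nw)\<close> is eventually \<open>0\<close>.

  Degree and leading coefficient come from comparing the number of tables with the volume of the
  union of the unit cubes at the corresponding lattice points, in an arbitrary lattice chart. Since the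
  limit does not depend on the chart, neither does the relative volume.
\<close>

section \<open>Counting tables along a line of margins\<close>

definition evpoly :: "(nat \<Rightarrow> real) \<Rightarrow> bool" where
  "evpoly f \<longleftrightarrow> (\<exists>p. \<forall>\<^sub>F n in sequentially. f n = poly p (real n))"

lemma evpoly_add: assumes "evpoly f" "evpoly g" shows "evpoly (\<lambda>n. f n + g n)"
proof -
  obtain p q where p: "\<forall>\<^sub>F n in sequentially. f n = poly p (real n)"
    and q: "\<forall>\<^sub>F n in sequentially. g n = poly q (real n)"
    using assms unfolding evpoly_def by blast
  from p q have "\<forall>\<^sub>F n in sequentially. f n + g n = poly (p + q) (real n)"
    by eventually_elim simp
  then show ?thesis unfolding evpoly_def by blast
qed

lemma evpoly_uminus: assumes "evpoly f" shows "evpoly (\<lambda>n. - f n)"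
proof -
  obtain p where p: "\<forall>\<^sub>F n in sequentially. f n = poly p (real n)"
    using assms unfolding evpoly_def by blast
  then have "\<forall>\<^sub>F n in sequentially. - f n = poly (- p) (real n)"
    by eventually_elim simp
  then show ?thesis unfolding evpoly_def by blast
qed

lemma evpoly_eventually_zero:
  assumes "\<forall>\<^sub>F n in sequentially. f n = 0" shows "evpoly f"
  unfolding evpoly_def using assms by (intro exI[of _ 0]) simp

text \<open>\<open>(x + 1)^(n + 1) - x^(n + 1)\<close> is \<open>(n + 1) * x^n\<close> plus lower
  powers of \<open>x\<close>. Subtracting from \<open>x^(n + 1)\<close> suitable multiples of
  antidifferences of those lower powers, which the induction supplies, leaves an antidifference of
  \<open>(n + 1) * x^n\<close>.\<close>

lemma antidifference_monom:
  "\<exists>q::real poly. \<forall>x. poly q (x + 1) - poly q x = x ^ n"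
proof (induction n rule: less_induct)
  case (less n)
  then obtain q :: "nat \<Rightarrow> real poly" where
    q: "\<And>k x. k < n \<Longrightarrow> poly (q k) (x + 1) - poly (q k) x = x ^ k"
    by metis
  define r where "r = monom 1 (Suc n) - (\<Sum>k<n. smult (of_nat (Suc n choose k)) (q k))"
  have "poly r (x + 1) - poly r x = real (Suc n) * x ^ n" for x
  proof -
    have "(x + 1) ^ Suc n = (\<Sum>k\<le>Suc n. of_nat (Suc n choose k) * x ^ k)"
      using binomial_ring[of x 1 "Suc n"] by simp
    also have "\<dots> = (\<Sum>k<n. of_nat (Suc n choose k) * x ^ k) + real (Suc n) * x ^ n + x ^ Suc n"
      by (simp add: lessThan_Suc_atMost[symmetric])
    finally have 1: "(x + 1) ^ Suc n - x ^ Suc n =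
      (\<Sum>k<n. of_nat (Suc n choose k) * x ^ k) + real (Suc n) * x ^ n" by simp
    have "poly r (x + 1) - poly r x = ((x + 1) ^ Suc n - x ^ Suc n) -
       (\<Sum>k<n. of_nat (Suc n choose k) * (poly (q k) (x + 1) - poly (q k) x))"
      by (simp add: r_def poly_monom poly_sum right_diff_distrib sum_subtractf del: power_Suc)
    also have "\<dots> = real (Suc n) * x ^ n"
      unfolding 1 by (simp add: q)
    finally show ?thesis .
  qed
  then show ?case
    by (intro exI[of _ "smult (1 / real (Suc n)) r"]) (simp add: diff_divide_distrib[symmetric])
qed

lemma antidifference:
  fixes p :: "real poly"
  shows "\<exists>q. \<forall>x. poly q (x + 1) - poly q x = poly p x"
proof -
  obtain q :: "nat \<Rightarrow> real poly" where
    q: "\<And>k x. poly (q k) (x + 1) - poly (q k) x = x ^ k"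
    using antidifference_monom by metis
  have "poly (\<Sum>i\<le>degree p. smult (coeff p i) (q i)) (x + 1) -
        poly (\<Sum>i\<le>degree p. smult (coeff p i) (q i)) x = poly p x" for x
  proof -
    have "poly p x = (\<Sum>i\<le>degree p. coeff p i * (poly (q i) (x + 1) - poly (q i) x))"
      by (simp only: q) (rule poly_altdef)
    then show ?thesis by (simp add: poly_sum right_diff_distrib sum_subtractf)
  qed
  then show ?thesis by blast
qed

text \<open>From \<open>N\<close> on, \<open>f\<close> and a polynomial antidifference
  \<open>q\<close> of its increments grow by the same amounts, so they differ by the constant
  \<open>f N - q(N)\<close>.\<close>

lemma evpoly_of_difference:
  assumes "evpoly (\<lambda>n. f (Suc n) - f n)" shows "evpoly f"
proof -
  obtain p N where p: "\<And>n. n \<ge> N \<Longrightarrow> f (Suc n) - f n = poly p (real n)"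
    using assms unfolding evpoly_def eventually_sequentially by blast
  obtain q where q: "\<And>x. poly q (x + 1) - poly q x = poly p x"
    using antidifference by blast
  have "f n = poly (q + [:f N - poly q (real N):]) (real n)" if "n \<ge> N" for n
    using that
  proof (induction n rule: nat_induct_at_least)
    case (Suc n)
    then show ?case using p[of n] q[of "real n"] by (simp add: algebra_simps)
  qed simp
  then show ?thesis unfolding evpoly_def eventually_sequentially by blast
qed

section \<open>Tables of nonnegative integers with prescribed support and margins\<close>

definition tables :: "nat \<Rightarrow> nat \<Rightarrow> (nat \<times> nat) set \<Rightarrow> (nat \<Rightarrow> int) \<Rightarrow> (nat \<Rightarrow> int) \<Rightarrow> (nat \<times> nat \<Rightarrow> nat) set"
  where "tables t s A a b = {M. (\<forall>x. x \<notin> A \<longrightarrow> M x = 0) \<and>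
    (\<forall>i<t. (\<Sum>j<s. int (M (i, j))) = a i) \<and> (\<forall>j<s. (\<Sum>i<t. int (M (i, j))) = b j)}"

lemma tables_cong:
  assumes "\<And>i. i < t \<Longrightarrow> a i = a' i" "\<And>j. j < s \<Longrightarrow> b j = b' j"
  shows "tables t s A a b = tables t s A a' b'"
  using assms unfolding tables_def by simp

lemma finite_tables:
  assumes "A \<subseteq> {..<t} \<times> {..<s}"
  shows "finite (tables t s A a b)"
proof (rule finite_subset)
  \<comment> \<open>Each entry is at most its row margin, hence at most the sum of the absolute row
    margins.\<close>
  define B where "B = nat (\<Sum>i<t. \<bar>a i\<bar>)"
  show "tables t s A a b \<subseteq> {M. \<forall>x. (x \<in> A \<longrightarrow> M x \<in> {..B}) \<and> (x \<notin> A \<longrightarrow> M x = 0)}"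
  proof safe
    fix M i j assume M: "M \<in> tables t s A a b" and ij: "(i, j) \<in> A"
    have i: "i < t" and j: "j < s" using ij assms by auto
    have "int (M (i, j)) \<le> (\<Sum>j<s. int (M (i, j)))"
      using j by (intro member_le_sum) auto
    also have "\<dots> \<le> \<bar>a i\<bar>" using M i by (auto simp: tables_def)
    also have "\<dots> \<le> (\<Sum>i<t. \<bar>a i\<bar>)" using i by (intro member_le_sum) auto
    finally show "M (i, j) \<le> B" by (simp add: B_def)
  qed (auto simp: tables_def)
  show "finite {M. \<forall>x. (x \<in> A \<longrightarrow> M x \<in> {..B}) \<and> (x \<notin> A \<longrightarrow> M x = 0)}"
    using assms by (intro finite_set_of_finite_funs) (auto intro: finite_subset)
qed

lemma sum_fun_upd_row:
  fixes f :: "nat \<times> nat \<Rightarrow> nat"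
  assumes "i0 < t" "j0 < s"
  shows "(\<Sum>j<s. int ((f((i0, j0) := m)) (i, j))) =
     (\<Sum>j<s. int (f (i, j))) + (if i = i0 then int m - int (f (i0, j0)) else 0)"
proof -
  have "(\<Sum>j<s. int ((f((i0, j0) := m)) (i, j))) =
    (\<Sum>j<s. int (f (i, j)) + (if j = j0 then (if i = i0 then int m - int (f (i0, j0)) else 0) else 0))"
    by (intro sum.cong) auto
  then show ?thesis using assms by (simp add: sum.distrib)
qed

lemma sum_fun_upd_col:
  fixes f :: "nat \<times> nat \<Rightarrow> nat"
  assumes "i0 < t" "j0 < s"
  shows "(\<Sum>i<t. int ((f((i0, j0) := m)) (i, j))) =
     (\<Sum>i<t. int (f (i, j))) + (if j = j0 then int m - int (f (i0, j0)) else 0)"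
proof -
  have "(\<Sum>i<t. int ((f((i0, j0) := m)) (i, j))) =
    (\<Sum>i<t. int (f (i, j)) + (if i = i0 then (if j = j0 then int m - int (f (i0, j0)) else 0) else 0))"
    by (intro sum.cong) auto
  then show ?thesis using assms by (simp add: sum.distrib)
qed

text \<open>A table either vanishes at the cell or stays nonnegative when that entry is lowered.\<close>

lemma card_tables_delete:
  assumes "A \<subseteq> {..<t} \<times> {..<s}" "(i0, j0) \<in> A"
  shows "card (tables t s A a b) = card (tables t s (A - {(i0, j0)}) a b) +
    card (tables t s A (\<lambda>i. a i - of_bool (i = i0)) (\<lambda>j. b j - of_bool (j = j0)))"
proof -
  let ?a = "\<lambda>i. a i - of_bool (i = i0)" and ?b = "\<lambda>j. b j - of_bool (j = j0)"
  let ?Z = "tables t s (A - {(i0, j0)}) a b"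
  let ?P = "{M \<in> tables t s A a b. M (i0, j0) > 0}"
  have lt: "i0 < t" "j0 < s" using assms by auto
  have sp: "tables t s A a b = ?Z \<union> ?P" and disj: "?Z \<inter> ?P = {}"
    using assms(2) by (auto simp: tables_def)
  have fin: "finite (tables t s A a b)" by (rule finite_tables[OF assms(1)])
  have "bij_betw (\<lambda>M. M((i0, j0) := M (i0, j0) + 1)) (tables t s A ?a ?b) ?P"
  proof (rule bij_betw_byWitness[where f' = "\<lambda>M. M((i0, j0) := M (i0, j0) - 1)"])
    show "(\<lambda>M. M((i0, j0) := M (i0, j0) + 1)) ` tables t s A ?a ?b \<subseteq> ?P"
    proof (intro image_subsetI CollectI conjI)
      fix M assume M: "M \<in> tables t s A ?a ?b"
      have "\<forall>x. x \<notin> A \<longrightarrow> (M((i0, j0) := M (i0, j0) + 1)) x = 0"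
        using M assms(2) by (auto simp: tables_def)
      then show "M((i0, j0) := M (i0, j0) + 1) \<in> tables t s A a b"
        using M unfolding tables_def mem_Collect_eq sum_fun_upd_row[OF lt] sum_fun_upd_col[OF lt]
        by simp
    qed simp
    show "(\<lambda>M. M((i0, j0) := M (i0, j0) - 1)) ` ?P \<subseteq> tables t s A ?a ?b"
    proof (intro image_subsetI)
      fix M assume M: "M \<in> ?P"
      have "\<forall>x. x \<notin> A \<longrightarrow> (M((i0, j0) := M (i0, j0) - 1)) x = 0"
        using M assms(2) by (auto simp: tables_def)
      then show "M((i0, j0) := M (i0, j0) - 1) \<in> tables t s A ?a ?b"
        using M unfolding tables_def mem_Collect_eq sum_fun_upd_row[OF lt] sum_fun_upd_col[OF lt]
        by (simp add: of_nat_diff)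
    qed
  qed auto
  then have "card (tables t s A ?a ?b) = card ?P" by (rule bij_betw_same_card)
  moreover have "card (?Z \<union> ?P) = card ?Z + card ?P"
    by (rule card_Un_disjoint) (use fin disj in \<open>simp_all add: finite_tables[OF subset_trans[OF Diff_subset assms(1)]]\<close>)
  ultimately show ?thesis using sp by argo
qed

text \<open>No cell of \<open>A\<close> joins \<open>I\<close> to the complement of \<open>J\<close>
  or \<open>J\<close> to the complement of \<open>I\<close>. Hence both sides equal the total of the
  block \<open>I \<times> J\<close>.\<close>

lemma tables_cut:
  assumes A: "A \<subseteq> {..<t} \<times> {..<s}"
    and I: "I \<subseteq> {..<t}" and J: "J \<subseteq> {..<s}"
    and cut: "\<And>i j. (i, j) \<in> A \<Longrightarrow> i \<in> I \<longleftrightarrow> j \<in> J"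
    and M: "M \<in> tables t s A a b"
  shows "sum a I = sum b J"
proof -
  have z: "M (i, j) = 0" if "\<not> (i \<in> I \<longleftrightarrow> j \<in> J)" for i j
  proof -
    have "(i, j) \<notin> A" using cut that by blast
    then show ?thesis using M by (simp add: tables_def)
  qed
  have "sum a I = (\<Sum>i\<in>I. \<Sum>j<s. int (M (i, j)))"
    using M I by (intro sum.cong) (auto simp: tables_def)
  also have "\<dots> = (\<Sum>i\<in>I. \<Sum>j\<in>J. int (M (i, j)))"
    using J z by (intro sum.cong sum.mono_neutral_right) auto
  also have "\<dots> = (\<Sum>j\<in>J. \<Sum>i\<in>I. int (M (i, j)))" by (rule sum.swap)
  also have "\<dots> = (\<Sum>j\<in>J. \<Sum>i<t. int (M (i, j)))"
    using I z by (intro sum.cong sum.mono_neutral_left) auto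
  also have "\<dots> = sum b J"
    using M J by (intro sum.cong) (auto simp: tables_def)
  finally show ?thesis .
qed

text \<open>The induction on the number of cells treats all margins at once. Connectivity of the
  bipartite graph \<open>A\<close> is handled without paths: the sets \<open>I\<close> and
  \<open>J\<close> below stand in for the component of row 0.\<close>

lemma evpoly_card_tables_line:
  assumes A: "A \<subseteq> {..<t} \<times> {..<s}" and "0 < s" "0 < t" "coprime s t"
  shows "evpoly (\<lambda>n. real (card (tables t s A (\<lambda>i. a i + int n * int s) (\<lambda>j. b j + int n * int t))))"
  using A
proof (induction "card A" arbitrary: A a b rule: less_induct)
  case less
  define F where "F a b n = real (card (tables t s A (\<lambda>i. a i + int n * int s) (\<lambda>j. b j + int n * int t)))"
    for a b n
  \<comment> \<open>Shifts that change the count by an eventually polynomial amount. Quantifying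
    over every base margin, with integers so that negative shifts are allowed, makes these shifts a
    group.\<close>
  define H where "H p q \<longleftrightarrow> (\<forall>a b. evpoly (\<lambda>n. F (\<lambda>i. a i + p i) (\<lambda>j. b j + q j) n - F a b n))"
    for p q
  have H_add: "H (\<lambda>i. p i + p' i) (\<lambda>j. q j + q' j)" if "H p q" "H p' q'" for p q p' q'
    unfolding H_def
  proof (intro allI)
    fix a b :: "nat \<Rightarrow> int"
    have 1: "evpoly (\<lambda>n. F (\<lambda>i. (a i + p i) + p' i) (\<lambda>j. (b j + q j) + q' j) n - F (\<lambda>i. a i + p i) (\<lambda>j. b j + q j) n)"
      by (rule that(2)[unfolded H_def, rule_format])
    have 2: "evpoly (\<lambda>n. F (\<lambda>i. a i + p i) (\<lambda>j. b j + q j) n - F a b n)"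
      by (rule that(1)[unfolded H_def, rule_format])
    show "evpoly (\<lambda>n. F (\<lambda>i. a i + (p i + p' i)) (\<lambda>j. b j + (q j + q' j)) n - F a b n)"
      using evpoly_add[OF 1 2] by (simp add: add.assoc)
  qed
  have H_minus: "H (\<lambda>i. - p i) (\<lambda>j. - q j)" if "H p q" for p q
    unfolding H_def
  proof (intro allI)
    fix a b :: "nat \<Rightarrow> int"
    have "evpoly (\<lambda>n. F (\<lambda>i. (a i - p i) + p i) (\<lambda>j. (b j - q j) + q j) n - F (\<lambda>i. a i - p i) (\<lambda>j. b j - q j) n)"
      by (rule that[unfolded H_def, rule_format])
    then show "evpoly (\<lambda>n. F (\<lambda>i. a i + - p i) (\<lambda>j. b j + - q j) n - F a b n)"
      by (drule_tac evpoly_uminus) simp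
  qed
  have H_zero: "H (\<lambda>i. 0) (\<lambda>j. 0)"
    by (simp add: H_def evpoly_eventually_zero)
  have H_mult: "H (\<lambda>i. int m * p i) (\<lambda>j. int m * q j)" if "H p q" for p q m
    using H_zero by (induction m) (auto simp: distrib_right intro: H_add that)
  have H_sum: "H (\<lambda>i. \<Sum>x\<in>X. p x i) (\<lambda>j. \<Sum>x\<in>X. q x j)" if "finite X" "\<And>x. x \<in> X \<Longrightarrow> H (p x) (q x)"
    for X :: "nat set" and p q
    using that H_zero by (induction X rule: finite_induct) (auto intro: H_add)
  \<comment> \<open>The deletion identity turns this difference into the count for the support
    without the cell, to which the induction hypothesis applies.\<close>
  have H_edge: "H (\<lambda>i. of_bool (i = i0)) (\<lambda>j. of_bool (j = j0))" if e: "(i0, j0) \<in> A" for i0 j0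
    unfolding H_def
  proof (intro allI)
    fix a b :: "nat \<Rightarrow> int"
    let ?a = "\<lambda>i. a i + of_bool (i = i0)" and ?b = "\<lambda>j. b j + of_bool (j = j0)"
    have "finite A" using less.prems by (rule finite_subset) auto
    then have "card (A - {(i0, j0)}) < card A" using e by (rule card_Diff1_less)
    then have "evpoly (\<lambda>n. real (card (tables t s (A - {(i0, j0)})
       (\<lambda>i. ?a i + int n * int s) (\<lambda>j. ?b j + int n * int t))))"
      using less.prems by (intro less.hyps) auto
    moreover have "real (card (tables t s (A - {(i0, j0)}) (\<lambda>i. ?a i + int n * int s) (\<lambda>j. ?b j + int n * int t))) =
       F ?a ?b n - F a b n" for n
      using card_tables_delete[OF less.prems e, of "\<lambda>i. ?a i + int n * int s" "\<lambda>j. ?b j + int n * int t"]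
      by (simp add: F_def)
    ultimately show "evpoly (\<lambda>n. F ?a ?b n - F a b n)" by simp
  qed
  \<comment> \<open>Row 0 is the root. With e_i and f_j the unit margins of row i and column j,
    \<open>I\<close> collects the rows with e_i - e_0 in the group and \<open>J\<close> the columns
    with e_0 + f_j in it. A cell (i, j) of \<open>A\<close> puts e_i + f_j = (e_i - e_0) + (e_0 +
    f_j) into the group, so \<open>I\<close> and \<open>J\<close> agree along it.\<close>
  define I where "I = {i. i < t \<and> H (\<lambda>k. of_bool (k = i) - of_bool (k = 0)) (\<lambda>k. 0)}"
  define J where "J = {j. j < s \<and> H (\<lambda>k. of_bool (k = 0)) (\<lambda>k. of_bool (k = j))}"
  have cut: "i \<in> I \<longleftrightarrow> j \<in> J" if e: "(i, j) \<in> A" for i j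
  proof
    assume "i \<in> I"
    then have "H (\<lambda>k. - (of_bool (k = i) - of_bool (k = 0))) (\<lambda>k. - 0)"
      unfolding I_def by (intro H_minus) simp
    from H_add[OF H_edge[OF e] this] show "j \<in> J"
      using e less.prems by (auto simp: J_def)
  next
    assume "j \<in> J"
    then have "H (\<lambda>k. - of_bool (k = 0)) (\<lambda>k. - of_bool (k = j))"
      unfolding J_def by (intro H_minus) simp
    from H_add[OF H_edge[OF e] this] show "i \<in> I"
      using e less.prems by (auto simp: I_def)
  qed
  have "0 \<in> I" using H_zero \<open>0 < t\<close> by (simp add: I_def)
  show ?case
  proof (cases "I = {..<t} \<and> J = {..<s}")
    case True
    \<comment> \<open>The step of the line is s times the sum of all e_i - e_0 plus t times the sum
      of all e_0 + f_j: the multiples -st and st of e_0 cancel.\<close>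
    have 1: "H (\<lambda>k. \<Sum>i<t. int s * (of_bool (k = i) - of_bool (k = 0))) (\<lambda>k. \<Sum>i<t. int s * 0)"
      using True by (intro H_sum H_mult) (auto simp: I_def)
    have 2: "H (\<lambda>k. \<Sum>j<s. int t * of_bool (k = 0)) (\<lambda>k. \<Sum>j<s. int t * of_bool (k = j))"
      using True by (intro H_sum H_mult) (auto simp: J_def)
    have w1: "(\<Sum>i<t. int s * (of_bool (k = i) - of_bool (k = 0))) + (\<Sum>j<s. int t * of_bool (k = 0)) = int s"
      if "k < t" for k
    proof -
      have "(\<Sum>i<t. of_bool (k = i) :: int) = 1"
        using that by (simp add: of_bool_def)
      then show ?thesis by (simp add: sum_subtractf algebra_simps flip: sum_distrib_left)
    qed
    have w2: "(\<Sum>i<t. int s * 0) + (\<Sum>j<s. int t * of_bool (k = j)) = int t" if "k < s" for k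
      using that by (simp add: of_bool_def if_distrib cong: if_cong)
    have step: "F (\<lambda>k. a k + ((\<Sum>i<t. int s * (of_bool (k = i) - of_bool (k = 0))) + (\<Sum>j<s. int t * of_bool (k = 0))))
       (\<lambda>k. b k + ((\<Sum>i<t. int s * 0) + (\<Sum>j<s. int t * of_bool (k = j)))) n = F a b (Suc n)" for n
      unfolding F_def by (rule arg_cong[where f = "\<lambda>X. real (card X)"], rule tables_cong)
         (simp_all only: w1 w2, simp_all add: algebra_simps)
    have "evpoly (\<lambda>n. F a b (Suc n) - F a b n)"
      unfolding step[symmetric] by (rule H_add[OF 1 2, unfolded H_def, rule_format])
    then have "evpoly (F a b)" by (rule evpoly_of_difference)
    then show ?thesis unfolding F_def .
  next
    case False
    have Is: "I \<subseteq> {..<t}" and Js: "J \<subseteq> {..<s}" by (auto simp: I_def J_def)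
    \<comment> \<open>Equality would make t divide the size of \<open>I\<close>, which lies between
      1 and t because 0 is in \<open>I\<close>. Then \<open>I\<close> and \<open>J\<close> would
      both be full, which this case excludes.\<close>
    have slope: "card I * s \<noteq> card J * t"
    proof
      assume eq: "card I * s = card J * t"
      then have "t dvd card I * s" by simp
      then have "t dvd card I" using \<open>coprime s t\<close> by (simp add: coprime_commute coprime_dvd_mult_left_iff)
      moreover have "card I > 0" using \<open>0 \<in> I\<close> Is by (auto simp: card_gt_0_iff intro: finite_subset)
      moreover have "card I \<le> t" using card_mono[OF _ Is] by simp
      ultimately have "card I = t" by (simp add: dvd_imp_le le_antisym)
      moreover from this eq have "card J = s" using \<open>0 < t\<close> by simp
      ultimately show False using False Is Js by (metis card_lessThan card_subset_eq finite_lessThan)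
    qed
    \<comment> \<open>Along the cut, the fixed imbalance of \<open>a\<close> and \<open>b\<close>
      would have to be n times a nonzero integer.\<close>
    have "F a b n = 0" if n: "n > nat \<bar>sum a I - sum b J\<bar>" for n
    proof (rule ccontr)
      assume "F a b n \<noteq> 0"
      then obtain M where "M \<in> tables t s A (\<lambda>i. a i + int n * int s) (\<lambda>j. b j + int n * int t)"
        unfolding F_def by fastforce
      from tables_cut[OF less.prems Is Js cut this]
      have "sum a I - sum b J = int n * (int (card J * t) - int (card I * s))"
        by (simp add: sum.distrib algebra_simps)
      then have "\<bar>sum a I - sum b J\<bar> = int n * \<bar>int (card J * t) - int (card I * s)\<bar>"
        by (simp add: abs_mult)
      moreover have "\<bar>int (card J * t) - int (card I * s)\<bar> \<ge> 1" using slope by linarith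
      ultimately have "\<bar>sum a I - sum b J\<bar> \<ge> int n"
        by (metis mult.right_neutral mult_left_mono of_nat_0_le_iff)
      then show False using n by linarith
    qed
    then have "evpoly (F a b)"
      by (intro evpoly_eventually_zero) (auto simp: eventually_at_top_dense)
    then show ?thesis unfolding F_def .
  qed
qed

section \<open>Lattice points and volume\<close>

text \<open>The right-hand side is a scaled image measure. On boxes the one-dimensional affine rule,
  applied in each coordinate, shows that it agrees with the product measure, and boxes determine
  that measure.\<close>

lemma emeasure_PiM_lborel_affine:
  fixes c :: "nat \<Rightarrow> real"
  assumes r: "r > 0" and A: "A \<in> sets (\<Pi>\<^sub>M i\<in>{..<d}. lborel)"
  shows "emeasure (\<Pi>\<^sub>M i\<in>{..<d}. lborel) A = ennreal (r ^ d) *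
    emeasure (\<Pi>\<^sub>M i\<in>{..<d}. lborel)
      {f \<in> space (\<Pi>\<^sub>M i\<in>{..<d}. lborel). (\<lambda>i\<in>{..<d}. c i + r * f i) \<in> A}"
proof -
  let ?M = "\<Pi>\<^sub>M i\<in>{..<d}. (lborel :: real measure)"
  let ?g = "\<lambda>f. \<lambda>i\<in>{..<d}. c i + r * f i"
  interpret finite_product_sigma_finite "\<lambda>_. lborel :: real measure" "{..<d}"
    by standard simp
  have g: "?g \<in> measurable ?M ?M"
    by (intro measurable_restrict) measurable
  define P where "P = scale_measure (ennreal (r ^ d)) (distr ?M ?M ?g)"
  have P: "emeasure P X = ennreal (r ^ d) * emeasure ?M {f \<in> space ?M. ?g f \<in> X}"
    if "X \<in> sets ?M" for X
    using that g by (simp add: P_def emeasure_distr vimage_def Int_def conj_commute)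
  have "P = ?M"
  proof (rule PiM_eqI)
    fix B :: "nat \<Rightarrow> real set" assume B: "\<And>i. i \<in> {..<d} \<Longrightarrow> B i \<in> sets lborel"
    have 1: "emeasure lborel (B i) = ennreal r * emeasure lborel ((\<lambda>x. c i + r * x) -` B i)"
      if "i < d" for i
    proof -
      have Bi: "B i \<in> sets borel" using B that by simp
      have "emeasure lborel (B i) = emeasure (density (distr lborel borel (\<lambda>x. c i + r * x)) (\<lambda>_. ennreal \<bar>r\<bar>)) (B i)"
        using lborel_real_affine[of r "c i"] r by simp
      also have "\<dots> = ennreal r * emeasure (distr lborel borel (\<lambda>x. c i + r * x)) (B i)"
        using r Bi by (subst emeasure_density_const) auto
      also have "\<dots> = ennreal r * emeasure lborel ((\<lambda>x. c i + r * x) -` B i)"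
        using Bi by (simp add: emeasure_distr)
      finally show ?thesis .
    qed
    have box: "{f \<in> space ?M. ?g f \<in> Pi\<^sub>E {..<d} B} = Pi\<^sub>E {..<d} (\<lambda>i. (\<lambda>x. c i + r * x) -` B i)"
      by (auto simp: space_PiM PiE_def Pi_def)
    have m: "(\<lambda>x. c i + r * x) -` B i \<in> sets lborel" if "i < d" for i
    proof -
      have "(\<lambda>x. c i + r * x) \<in> measurable borel borel" by measurable
      from measurable_sets[OF this, of "B i"] B that show ?thesis by simp
    qed
    have "emeasure P (Pi\<^sub>E {..<d} B) = ennreal (r ^ d) * (\<Prod>i<d. emeasure lborel ((\<lambda>x. c i + r * x) -` B i))"
    proof -
      have "emeasure P (Pi\<^sub>E {..<d} B) = ennreal (r ^ d) * emeasure ?M {f \<in> space ?M. ?g f \<in> Pi\<^sub>E {..<d} B}"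
        using B by (intro P sets_PiM_I_finite) auto
      also have "emeasure ?M {f \<in> space ?M. ?g f \<in> Pi\<^sub>E {..<d} B} = (\<Prod>i<d. emeasure lborel ((\<lambda>x. c i + r * x) -` B i))"
        unfolding box using m by (intro emeasure_PiM) auto
      finally show ?thesis .
    qed
    also have "\<dots> = (\<Prod>i<d. ennreal r * emeasure lborel ((\<lambda>x. c i + r * x) -` B i))"
      using r by (simp add: prod.distrib ennreal_power)
    also have "\<dots> = (\<Prod>i<d. emeasure lborel (B i))"
      by (intro prod.cong) (simp_all add: 1)
    finally show "emeasure P (Pi\<^sub>E {..<d} B) = (\<Prod>i<d. emeasure lborel (B i))" .
  qed (simp_all add: P_def)
  then show ?thesis using P[OF A] by simp
qed

lemma abs_linear_form_le:
  fixes c w :: "nat \<Rightarrow> real"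
  assumes "\<And>k. k < d \<Longrightarrow> \<bar>w k\<bar> \<le> \<epsilon>"
  shows "\<bar>\<Sum>k<d. c k * w k\<bar> \<le> \<epsilon> * (\<Sum>k<d. \<bar>c k\<bar>)"
proof -
  have "\<bar>\<Sum>k<d. c k * w k\<bar> \<le> (\<Sum>k<d. \<bar>c k * w k\<bar>)" by (rule sum_abs)
  also have "\<dots> \<le> (\<Sum>k<d. \<epsilon> * \<bar>c k\<bar>)"
  proof (intro sum_mono)
    fix k assume "k \<in> {..<d}"
    then have "\<bar>w k\<bar> * \<bar>c k\<bar> \<le> \<epsilon> * \<bar>c k\<bar>" using assms by (intro mult_right_mono) auto
    then show "\<bar>c k * w k\<bar> \<le> \<epsilon> * \<bar>c k\<bar>" by (simp add: abs_mult mult.commute)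
  qed
  finally show ?thesis by (simp add: sum_distrib_left)
qed

text \<open>In the application \<open>E\<close> is the set of cells of the table, and
  \<open>c e\<close> is the linear part of the entry at \<open>e\<close> in chart
  coordinates.\<close>

locale half_spaces =
  fixes d :: nat and E :: "'e set" and c :: "'e \<Rightarrow> nat \<Rightarrow> real"
  assumes finite_E: "finite E"
begin

abbreviation "M \<equiv> (\<Pi>\<^sub>M i\<in>{..<d}. (lborel :: real measure))"

definition region :: "('e \<Rightarrow> real) \<Rightarrow> (nat \<Rightarrow> real) set" where
  "region m = {x \<in> Pi\<^sub>E {..<d} (\<lambda>_. UNIV). \<forall>e\<in>E. (\<Sum>k<d. c e k * x k) \<ge> - m e}"

definition lattice :: "(nat \<Rightarrow> real) set" where
  "lattice = Pi\<^sub>E {..<d} (\<lambda>_. \<int>)"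

lemma region_sets [measurable]: "region m \<in> sets M"
proof -
  have "{x \<in> space M. \<forall>e\<in>E. (\<Sum>k<d. c e k * x k) \<ge> - m e} \<in> sets M"
    using finite_E by measurable
  then show ?thesis by (simp add: region_def space_PiM)
qed

lemma emeasure_region_scale:
  assumes "r > 0"
  shows "emeasure M (region (\<lambda>_. r)) = ennreal (r ^ d) * emeasure M (region (\<lambda>_. 1))"
proof -
  have "(\<Sum>k<d. c e k * (r * f k)) = r * (\<Sum>k<d. c e k * f k)" for e f
    by (simp add: sum_distrib_left algebra_simps)
  then have "(- r \<le> (\<Sum>k<d. c e k * (r * f k))) \<longleftrightarrow> - 1 \<le> (\<Sum>k<d. c e k * f k)" for e f
    using assms by (metis mult_le_cancel_left_pos mult_minus1_right)
  then have "{f \<in> space M. (\<lambda>i\<in>{..<d}. 0 + r * f i) \<in> region (\<lambda>_. r)} = region (\<lambda>_. 1)"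
    by (auto simp: region_def space_PiM)
  then show ?thesis
    using emeasure_PiM_lborel_affine[where c = "\<lambda>_. 0", OF assms region_sets[of "\<lambda>_. r"]] by simp
qed

text \<open>A small cube at the origin satisfies every constraint.\<close>

lemma region_positive: "emeasure M (region (\<lambda>_. 1)) > 0"
proof -
  interpret finite_product_sigma_finite "\<lambda>_. lborel :: real measure" "{..<d}"
    by standard simp
  define C where "C = (\<Sum>e\<in>E. \<Sum>k<d. \<bar>c e k\<bar>)"
  \<comment> \<open>The added 1 keeps the denominator positive when all the linear forms
    vanish.\<close>
  define \<epsilon> where "\<epsilon> = 1 / (C + 1)"
  have C: "C \<ge> 0" by (auto simp: C_def intro!: sum_nonneg)
  then have \<epsilon>: "\<epsilon> > 0" by (simp add: \<epsilon>_def)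
  have "Pi\<^sub>E {..<d} (\<lambda>_. {0..\<epsilon>}) \<subseteq> region (\<lambda>_. 1)"
  proof
    fix x assume x: "x \<in> Pi\<^sub>E {..<d} (\<lambda>_. {0..\<epsilon>})"
    have "- 1 \<le> (\<Sum>k<d. c e k * x k)" if "e \<in> E" for e
    proof -
      have "\<bar>\<Sum>k<d. c e k * x k\<bar> \<le> \<epsilon> * (\<Sum>k<d. \<bar>c e k\<bar>)"
        using x by (intro abs_linear_form_le) (auto simp: PiE_iff)
      also have "\<dots> \<le> \<epsilon> * C"
        unfolding C_def using \<epsilon> that finite_E
        by (intro mult_left_mono member_le_sum[where f = "\<lambda>e. \<Sum>k<d. \<bar>c e k\<bar>"]) (auto intro: sum_nonneg)
      also have "\<dots> \<le> 1" using C by (simp add: \<epsilon>_def)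
      finally show ?thesis by linarith
    qed
    then show "x \<in> region (\<lambda>_. 1)" using x by (auto simp: region_def PiE_iff)
  qed
  then have "emeasure M (Pi\<^sub>E {..<d} (\<lambda>_. {0..\<epsilon>})) \<le> emeasure M (region (\<lambda>_. 1))"
    by (intro emeasure_mono) auto
  moreover have "emeasure M (Pi\<^sub>E {..<d} (\<lambda>_. {0..\<epsilon>})) = ennreal (\<epsilon> ^ d)"
    using \<epsilon> by (subst emeasure_PiM) (auto simp: ennreal_power)
  ultimately show ?thesis using \<epsilon> by (metis ennreal_less_zero_iff order_less_le_trans zero_less_power)
qed

text \<open>Half-open, so that the cubes at lattice points are disjoint and cover the space.\<close>

definition cube :: "(nat \<Rightarrow> real) \<Rightarrow> (nat \<Rightarrow> real) set" where
  "cube z = Pi\<^sub>E {..<d} (\<lambda>i. {z i..<z i + 1})"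

lemma cube_sets [measurable]: "cube z \<in> sets M"
  unfolding cube_def by (rule sets_PiM_I_finite) auto

lemma disjoint_family_cube: "disjoint_family_on cube lattice"
proof (unfold disjoint_family_on_def, intro ballI impI)
  fix z z' assume zz: "z \<in> lattice" "z' \<in> lattice" "z \<noteq> z'"
  show "cube z \<inter> cube z' = {}"
  proof (rule ccontr)
    assume "cube z \<inter> cube z' \<noteq> {}"
    then obtain x where x: "x \<in> cube z" "x \<in> cube z'" by blast
    have "z k = z' k" if k: "k < d" for k
    proof -
      have "z k \<in> \<int>" "z' k \<in> \<int>" using zz k by (auto simp: lattice_def PiE_iff)
      then obtain u v where uv: "z k = of_int u" "z' k = of_int v" by (auto elim!: Ints_cases)
      have "z k \<le> x k" "x k < z k + 1" "z' k \<le> x k" "x k < z' k + 1"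
        using x k by (auto simp: cube_def PiE_iff)
      then have "u = v" unfolding uv by linarith
      then show ?thesis using uv by simp
    qed
    then have "z = z'" using zz unfolding lattice_def by (intro PiE_ext) auto
    then show False using zz by simp
  qed
qed

lemma emeasure_Union_cubes:
  assumes "finite S" "S \<subseteq> lattice"
  shows "emeasure M (\<Union>z\<in>S. cube z) = of_nat (card S)"
proof -
  interpret finite_product_sigma_finite "\<lambda>_. lborel :: real measure" "{..<d}"
    by standard simp
  have "emeasure M (cube z) = 1" for z
    unfolding cube_def by (subst emeasure_PiM) auto
  moreover have "disjoint_family_on cube S"
    using disjoint_family_cube assms(2) by (rule disjoint_family_on_mono[rotated])
  ultimately show ?thesis
    using assms(1) by (subst sum_emeasure[symmetric]) auto
qed

text \<open>Inside a unit cube each linear form varies by at most \<open>C\<close>. So the cubes at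
  the lattice points of \<open>region m\<close> cover the smaller region and stay inside the larger
  one, while their total volume is the number of these points.\<close>

lemma lattice_count_bounds:
  assumes fin: "finite (lattice \<inter> region m)"
    and C: "\<And>e. e \<in> E \<Longrightarrow> (\<Sum>k<d. \<bar>c e k\<bar>) \<le> C"
    and lo: "\<And>e. e \<in> E \<Longrightarrow> r + C \<le> m e" and hi: "\<And>e. e \<in> E \<Longrightarrow> m e + C \<le> r'"
  shows "emeasure M (region (\<lambda>_. r)) \<le> of_nat (card (lattice \<inter> region m))"
    and "of_nat (card (lattice \<inter> region m)) \<le> emeasure M (region (\<lambda>_. r'))"
proof -
  let ?U = "\<Union>z\<in>lattice \<inter> region m. cube z"
  have U: "emeasure M ?U = of_nat (card (lattice \<inter> region m))"
    using fin by (rule emeasure_Union_cubes) simp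
  have Usets: "?U \<in> sets M" using fin by auto
  have close: "\<bar>(\<Sum>k<d. c e k * x k) - (\<Sum>k<d. c e k * z k)\<bar> \<le> C"
    if "x \<in> cube z" "e \<in> E" for x z e
  proof -
    have "\<bar>\<Sum>k<d. c e k * (x k - z k)\<bar> \<le> 1 * (\<Sum>k<d. \<bar>c e k\<bar>)"
      using that(1) by (intro abs_linear_form_le) (force simp: cube_def PiE_iff)
    then show ?thesis using C[OF that(2)] by (simp add: algebra_simps sum_subtractf)
  qed
  have "region (\<lambda>_. r) \<subseteq> ?U"
  proof
    fix x assume x: "x \<in> region (\<lambda>_. r)"
    define z where "z = (\<lambda>k\<in>{..<d}. of_int \<lfloor>x k\<rfloor> :: real)"
    have xz: "x \<in> cube z"
      using x by (auto simp: cube_def z_def region_def PiE_iff)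
    have "- m e \<le> (\<Sum>k<d. c e k * z k)" if "e \<in> E" for e
    proof -
      have "- r \<le> (\<Sum>k<d. c e k * x k)" using x that by (auto simp: region_def)
      with close[OF xz that] lo[OF that] show ?thesis by linarith
    qed
    then have "z \<in> lattice \<inter> region m" by (auto simp: z_def lattice_def region_def)
    then show "x \<in> ?U" using xz by blast
  qed
  then show "emeasure M (region (\<lambda>_. r)) \<le> of_nat (card (lattice \<inter> region m))"
    unfolding U[symmetric] by (rule emeasure_mono) (rule Usets)
  have "?U \<subseteq> region (\<lambda>_. r')"
  proof (intro UN_least subsetI)
    fix z x assume z: "z \<in> lattice \<inter> region m" and x: "x \<in> cube z"
    have "- r' \<le> (\<Sum>k<d. c e k * x k)" if "e \<in> E" for e
    proof -
      have "- m e \<le> (\<Sum>k<d. c e k * z k)" using z that by (auto simp: region_def)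
      with close[OF x that] hi[OF that] show ?thesis by linarith
    qed
    then show "x \<in> region (\<lambda>_. r')" using x by (auto simp: region_def cube_def PiE_iff)
  qed
  then show "of_nat (card (lattice \<inter> region m)) \<le> emeasure M (region (\<lambda>_. r'))"
    unfolding U[symmetric] by (rule emeasure_mono) (rule region_sets)
qed

text \<open>The count lies between the volumes of the dilations by \<open>n - C\<close> and
  \<open>n + C\<close> of the same body, and both volumes are asymptotic to \<open>n ^ d\<close>
  times its volume.\<close>

lemma lattice_count_asymptotics:
  assumes fin: "\<And>n::nat. finite (lattice \<inter> region (\<lambda>e. real n + m e))"
  shows "(\<lambda>n. real (card (lattice \<inter> region (\<lambda>e. real n + m e))) / real n ^ d)
           \<longlonglongrightarrow> measure M (region (\<lambda>_. 1))"
    and "0 < measure M (region (\<lambda>_. 1))"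
proof -
  let ?N = "\<lambda>n. card (lattice \<inter> region (\<lambda>e. real n + m e))"
  \<comment> \<open>\<open>C1\<close> bounds the variation of the forms over a unit cube;
    \<open>C\<close> also absorbs the offsets \<open>m e\<close>.\<close>
  define C1 where "C1 = (\<Sum>e\<in>E. \<Sum>k<d. \<bar>c e k\<bar>)"
  define C where "C = C1 + (\<Sum>e\<in>E. \<bar>m e\<bar>)"
  have C1: "(\<Sum>k<d. \<bar>c e k\<bar>) \<le> C1" if "e \<in> E" for e
    unfolding C1_def using that finite_E
    by (intro member_le_sum[where f = "\<lambda>e. \<Sum>k<d. \<bar>c e k\<bar>"]) (auto intro: sum_nonneg)
  have m: "\<bar>m e\<bar> \<le> C - C1" if "e \<in> E" for e
    unfolding C_def using that finite_E member_le_sum[of e E "\<lambda>e. \<bar>m e\<bar>"] by simp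
  have C0: "0 \<le> C" by (auto simp: C_def C1_def intro!: add_nonneg_nonneg sum_nonneg)
  let ?K = "region (\<lambda>_. 1)"
  have lower: "ennreal ((real n - C) ^ d) * emeasure M ?K \<le> of_nat (?N n)" if "real n > C" for n
  proof -
    have "real n - C + C1 \<le> real n + m e" "real n + m e + C1 \<le> real n + C" if "e \<in> E" for e
      using m[OF that] by auto
    then have "emeasure M (region (\<lambda>_. real n - C)) \<le> of_nat (?N n)"
      using fin C1 by (intro lattice_count_bounds(1)[where C = C1 and r' = "real n + C"]) auto
    then show ?thesis using emeasure_region_scale[of "real n - C"] that by simp
  qed
  have upper: "of_nat (?N n) \<le> ennreal ((real n + C) ^ d) * emeasure M ?K" if "real n > 0" for n
  proof -
    have "real n - C + C1 \<le> real n + m e" "real n + m e + C1 \<le> real n + C" if "e \<in> E" for e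
      using m[OF that] by auto
    then have "of_nat (?N n) \<le> emeasure M (region (\<lambda>_. real n + C))"
      using fin C1 by (intro lattice_count_bounds(2)[where C = C1 and r = "real n - C"]) auto
    then show ?thesis using emeasure_region_scale[of "real n + C"] that C0 by simp
  qed
  \<comment> \<open>Finite volume comes from the finite lattice point counts: \<open>lower\<close>
    at a single n above \<open>C\<close> suffices.\<close>
  have "emeasure M ?K \<noteq> \<infinity>"
  proof
    assume inf: "emeasure M ?K = \<infinity>"
    obtain n :: nat where n: "real n > C" using reals_Archimedean2 by blast
    then have "ennreal ((real n - C) ^ d) > 0" by simp
    then show False using lower[OF n] inf n by (simp add: ennreal_mult_top ennreal_of_nat_eq_real_of_nat top_unique)
  qed
  then have K: "emeasure M ?K = ennreal (measure M ?K)"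
    by (simp add: emeasure_eq_ennreal_measure)
  show "0 < measure M ?K"
    using region_positive unfolding K by simp
  have lower': "(1 - C / real n) ^ d * measure M ?K \<le> real (?N n) / real n ^ d" if "real n > C" for n
  proof -
    have "(real n - C) ^ d * measure M ?K \<le> real (?N n)"
      using lower[OF that] that unfolding K
      by (simp add: ennreal_of_nat_eq_real_of_nat flip: ennreal_mult)
    moreover have "(1 - C / real n) ^ d = (real n - C) ^ d / real n ^ d"
      using that C0 by (simp add: divide_simps flip: power_divide)
    ultimately show ?thesis by (simp add: divide_right_mono)
  qed
  have upper': "real (?N n) / real n ^ d \<le> (1 + C / real n) ^ d * measure M ?K" if "real n > C" for n
  proof -
    have "real (?N n) \<le> (real n + C) ^ d * measure M ?K"
      using upper[of n] that C0 unfolding K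
      by (simp add: ennreal_of_nat_eq_real_of_nat flip: ennreal_mult)
    moreover have "(1 + C / real n) ^ d = (real n + C) ^ d / real n ^ d"
      using that C0 by (simp add: divide_simps flip: power_divide)
    ultimately show ?thesis by (simp add: divide_right_mono)
  qed
  have Cn: "(\<lambda>n. C / real n) \<longlonglongrightarrow> 0"
    by (rule tendsto_divide_0[OF tendsto_const filterlim_real_sequentially[THEN filterlim_at_top_imp_at_infinity]])
  have big: "\<forall>\<^sub>F n in sequentially. real n > C"
    using filterlim_real_sequentially by (simp add: filterlim_at_top_dense)
  show "(\<lambda>n. real (?N n) / real n ^ d) \<longlonglongrightarrow> measure M ?K"
  proof (rule tendsto_sandwich)
    show "(\<lambda>n. (1 - C / real n) ^ d * measure M ?K) \<longlonglongrightarrow> measure M ?K"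
      using tendsto_mult[OF tendsto_power[OF tendsto_diff[OF tendsto_const[of 1] Cn], of d] tendsto_const[of "measure M ?K"]]
      by simp
    show "(\<lambda>n. (1 + C / real n) ^ d * measure M ?K) \<longlonglongrightarrow> measure M ?K"
      using tendsto_mult[OF tendsto_power[OF tendsto_add[OF tendsto_const[of 1] Cn], of d] tendsto_const[of "measure M ?K"]]
      by simp
  qed (use big lower' upper' in \<open>auto elim!: eventually_mono\<close>)
qed

end

section \<open>The transportation polytope\<close>

definition margin_space :: "nat \<Rightarrow> nat \<Rightarrow> (nat \<Rightarrow> nat \<Rightarrow> real) set" where
  "margin_space s t = {M. (\<forall>i j. (t \<le> i \<or> s \<le> j) \<longrightarrow> M i j = 0) \<and>
      (\<forall>i<t. (\<Sum>j<s. M i j) = real s) \<and> (\<forall>j<s. (\<Sum>i<t. M i j) = real t)}"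

text \<open>An integral matrix with the required margins and with positive entries. It serves as the
  origin of the chart coordinates.\<close>

definition ones :: "nat \<Rightarrow> nat \<Rightarrow> nat \<Rightarrow> nat \<Rightarrow> real" where
  "ones s t = (\<lambda>i j. if i < t \<and> j < s then 1 else 0)"

lemma ones_margin_space: "ones s t \<in> margin_space s t"
  by (auto simp: ones_def margin_space_def)

lemma transport_polytope_iff:
  "M \<in> transport_polytope s t \<longleftrightarrow> M \<in> margin_space s t \<and> (\<forall>i<t. \<forall>j<s. 0 \<le> M i j)"
  by (auto simp: transport_polytope_def margin_space_def)

lemma margin_space_affine:
  assumes "X \<in> margin_space s t" "Y \<in> margin_space s t"
  shows "(\<lambda>i j. (1 - u) * X i j + u * Y i j) \<in> margin_space s t"
proof -
  have *: "(\<Sum>j\<in>J. (1 - u) * f j + u * g j) = (1 - u) * sum f J + u * sum g J" for f g :: "nat \<Rightarrow> real" and J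
    by (simp add: sum.distrib sum_distrib_left)
  show ?thesis using assms unfolding margin_space_def mem_Collect_eq *
    by (simp add: left_diff_distrib)
qed

text \<open>For the harder inclusion, moving from the all-ones matrix a little way towards
  \<open>X\<close> keeps the entries nonnegative; \<open>X\<close> is then an affine combination of
  the two points of the polytope.\<close>

lemma aff_span_transport_polytope: "aff_span (transport_polytope s t) = margin_space s t"
proof (intro equalityI subsetI)
  fix X assume "X \<in> aff_span (transport_polytope s t)"
  then obtain S u where S: "finite S" "S \<subseteq> transport_polytope s t" "sum u S = 1"
    and X: "X = (\<lambda>i j. \<Sum>p\<in>S. u p * p i j)"
    unfolding aff_span_def by blast
  have S': "p \<in> margin_space s t" if "p \<in> S" for p
    using that S(2) transport_polytope_iff by blast
  have "(\<Sum>j<s. X i j) = real s" if "i < t" for i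
  proof -
    have "(\<Sum>j<s. X i j) = (\<Sum>p\<in>S. u p * (\<Sum>j<s. p i j))"
      unfolding X by (subst sum.swap) (simp add: sum_distrib_left)
    also have "\<dots> = (\<Sum>p\<in>S. u p * real s)"
      using S' that by (intro sum.cong) (auto simp: margin_space_def)
    finally show ?thesis using S(3) by (simp flip: sum_distrib_right)
  qed
  moreover have "(\<Sum>i<t. X i j) = real t" if "j < s" for j
  proof -
    have "(\<Sum>i<t. X i j) = (\<Sum>p\<in>S. u p * (\<Sum>i<t. p i j))"
      unfolding X by (subst sum.swap) (simp add: sum_distrib_left)
    also have "\<dots> = (\<Sum>p\<in>S. u p * real t)"
      using S' that by (intro sum.cong) (auto simp: margin_space_def)
    finally show ?thesis using S(3) by (simp flip: sum_distrib_right)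
  qed
  moreover have "X i j = 0" if "t \<le> i \<or> s \<le> j" for i j
    unfolding X using S' that by (auto intro!: sum.neutral simp: margin_space_def)
  ultimately show "X \<in> margin_space s t" by (auto simp: margin_space_def)
next
  fix X assume X: "X \<in> margin_space s t"
  let ?O = "ones s t"
  have O: "?O \<in> transport_polytope s t"
    using ones_margin_space by (auto simp: transport_polytope_iff ones_def)
  show "X \<in> aff_span (transport_polytope s t)"
  proof (cases "X = ?O")
    case True
    then show ?thesis using O unfolding aff_span_def
      by (intro CollectI exI[of _ "{?O}"] exI[of _ "\<lambda>_. 1"]) auto
  next
    case False
    \<comment> \<open>All entries of \<open>X\<close> have absolute value at most
      \<open>B - 1\<close>, so the step length \<open>1 / B\<close> leaves the entries
      \<open>(B - 1 + X i j) / B\<close> nonnegative.\<close>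
    define B where "B = 1 + (\<Sum>i<t. \<Sum>j<s. \<bar>X i j\<bar>)"
    define Y where "Y = (\<lambda>i j. (1 - 1 / B) * ?O i j + 1 / B * X i j)"
    have B: "B \<ge> 1" by (auto simp: B_def intro!: sum_nonneg)
    have XB: "\<bar>X i j\<bar> \<le> B - 1" if "i < t" "j < s" for i j
    proof -
      have "\<bar>X i j\<bar> \<le> (\<Sum>j<s. \<bar>X i j\<bar>)" using that by (intro member_le_sum) auto
      also have "\<dots> \<le> (\<Sum>i<t. \<Sum>j<s. \<bar>X i j\<bar>)"
        using that by (intro member_le_sum[where f = "\<lambda>i. \<Sum>j<s. \<bar>X i j\<bar>"]) (auto intro: sum_nonneg)
      finally show ?thesis by (simp add: B_def)
    qed
    have "0 \<le> Y i j" if "i < t" "j < s" for i j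
    proof -
      have "Y i j = (B - 1 + X i j) / B"
        using that B by (simp add: Y_def ones_def field_simps)
      then show ?thesis using XB[OF that] B by simp
    qed
    then have Y: "Y \<in> transport_polytope s t"
      using margin_space_affine[OF ones_margin_space X, of "1 / B"]
      by (simp add: transport_polytope_iff Y_def)
    have XY: "X = (\<lambda>i j. (1 - B) * ?O i j + B * Y i j)"
      using B by (intro ext) (simp add: Y_def field_simps)
    \<comment> \<open>The two points must differ for the sum over the set \<open>{?O, Y}\<close> to
      have two terms.\<close>
    have "?O \<noteq> Y"
    proof
      assume "?O = Y"
      then have "X i j = ?O i j" for i j using fun_cong[OF fun_cong[OF XY], of i j] by (simp add: algebra_simps)
      then show False using False by blast
    qed
    then have 1: "(\<lambda>i j. (1 - B) * ?O i j + B * Y i j) = (\<lambda>i j. \<Sum>p\<in>{?O, Y}. (if p = Y then B else 1 - B) * p i j)"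
      and 2: "(\<Sum>p\<in>{?O, Y}. if p = Y then B else 1 - B) = 1"
      by simp_all
    show ?thesis
      unfolding aff_span_def
      by (rule CollectI, rule exI[of _ "{?O, Y}"], rule exI[of _ "\<lambda>p. if p = Y then B else 1 - B"],
          intro conjI, simp, use O Y in simp, simp, rule 2, rule trans[OF XY 1])
  qed
qed

section \<open>Affine maps in coordinates\<close>

lemma affine_inverse:
  fixes T :: "(nat \<Rightarrow> nat \<Rightarrow> real) \<Rightarrow> (nat \<Rightarrow> real)"
  assumes bij: "bij_betw T A V" and aff: "\<And>x y u. x \<in> A \<Longrightarrow> y \<in> A \<Longrightarrow>
      T (\<lambda>i j. (1 - u) * x i j + u * y i j) = (\<lambda>k. (1 - u) * T x k + u * T y k)"
    and A: "\<And>x y u. x \<in> A \<Longrightarrow> y \<in> A \<Longrightarrow> (\<lambda>i j. (1 - u) * x i j + u * y i j) \<in> A"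
    and y: "y \<in> V" "y' \<in> V"
  shows "inv_into A T (\<lambda>k. (1 - u) * y k + u * y' k) =
     (\<lambda>i j. (1 - u) * inv_into A T y i j + u * inv_into A T y' i j)"
proof -
  let ?G = "inv_into A T"
  have G: "?G y \<in> A" "?G y' \<in> A" "T (?G y) = y" "T (?G y') = y'"
    using y bij by (auto simp: bij_betw_def inv_into_into f_inv_into_f)
  then have "T (\<lambda>i j. (1 - u) * ?G y i j + u * ?G y' i j) = (\<lambda>k. (1 - u) * y k + u * y' k)"
    using aff[OF G(1,2)] G(3,4) by simp
  then show ?thesis
    using bij_betw_inv_into_left[OF bij A[OF G(1,2), of u]] by simp
qed

text \<open>The increment of \<open>G\<close> from \<open>y0\<close> is linear. Homogeneity comes
  from affine combinations of \<open>y0\<close> and \<open>y0 + h\<close>, additivity from the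
  midpoint of \<open>y0 + 2h\<close> and \<open>y0 + 2h'\<close>; the formula then follows by adding
  one coordinate at a time.\<close>

lemma affine_coordinates:
  fixes G :: "(nat \<Rightarrow> real) \<Rightarrow> (nat \<Rightarrow> nat \<Rightarrow> real)" and d :: nat
  defines "V \<equiv> {f. \<forall>i\<ge>d. f i = 0}"
  assumes aff: "\<And>y y' u. y \<in> V \<Longrightarrow> y' \<in> V \<Longrightarrow>
      G (\<lambda>k. (1 - u) * y k + u * y' k) = (\<lambda>i j. (1 - u) * G y i j + u * G y' i j)"
    and y0: "y0 \<in> V" and h: "h \<in> V"
  shows "G (\<lambda>k. y0 k + h k) i j =
    G y0 i j + (\<Sum>k<d. (G (\<lambda>l. y0 l + of_bool (l = k)) i j - G y0 i j) * h k)"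
proof -
  define g where "g h = G (\<lambda>k. y0 k + h k) i j - G y0 i j" for h
  have V_add: "(\<lambda>k. y k + y' k) \<in> V" if "y \<in> V" "y' \<in> V" for y y' using that by (simp add: V_def)
  have V_scale: "(\<lambda>k. u * y k) \<in> V" if "y \<in> V" for y u using that by (simp add: V_def)
  have g_scale: "g (\<lambda>k. u * h k) = u * g h" if h: "h \<in> V" for h u
  proof -
    have "(\<lambda>k. y0 k + u * h k) = (\<lambda>k. (1 - u) * y0 k + u * (y0 k + h k))"
      by (intro ext) (simp add: algebra_simps)
    then have "G (\<lambda>k. y0 k + u * h k) i j = (1 - u) * G y0 i j + u * G (\<lambda>k. y0 k + h k) i j"
      using aff[OF y0 V_add[OF y0 h], of u] by simp
    then show ?thesis by (simp add: g_def algebra_simps)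
  qed
  have g_add: "g (\<lambda>k. h k + h' k) = g h + g h'" if h: "h \<in> V" "h' \<in> V" for h h'
  proof -
    let ?p = "\<lambda>k. y0 k + 2 * h k" and ?p' = "\<lambda>k. y0 k + 2 * h' k"
    have "(\<lambda>k. y0 k + (h k + h' k)) = (\<lambda>k. (1 - 1/2) * ?p k + 1/2 * ?p' k)"
      by (intro ext) (simp add: algebra_simps)
    moreover have "?p \<in> V" "?p' \<in> V" using h y0 by (auto simp: V_def)
    ultimately have "G (\<lambda>k. y0 k + (h k + h' k)) i j = (1 - 1/2) * G ?p i j + 1/2 * G ?p' i j"
      using aff[of ?p ?p' "1/2"] by simp
    then have "g (\<lambda>k. h k + h' k) = 1/2 * g (\<lambda>k. 2 * h k) + 1/2 * g (\<lambda>k. 2 * h' k)"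
      by (simp add: g_def algebra_simps)
    then show ?thesis using g_scale[OF h(1), of 2] g_scale[OF h(2), of 2] by simp
  qed
  have e: "(\<lambda>l. of_bool (l = k)) \<in> V" if "k < d" for k using that by (auto simp: V_def)
  have "g (\<lambda>k. if k < m then h k else 0) = (\<Sum>k<m. g (\<lambda>l. of_bool (l = k)) * h k)" if "m \<le> d" for m
    using that
  proof (induction m)
    case 0
    show ?case using g_scale[OF h, of 0] by simp
  next
    case (Suc m)
    have "(\<lambda>k. if k < Suc m then h k else 0) =
        (\<lambda>k. (if k < m then h k else 0) + h m * of_bool (k = m))"
      by (intro ext) (auto simp: less_Suc_eq)
    moreover have "(\<lambda>k. if k < m then h k else 0) \<in> V" using h by (auto simp: V_def)
    ultimately show ?case
      using g_add[OF _ V_scale[OF e[of m], of "h m"]] g_scale[OF e[of m], of "h m"] Suc by simp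
  qed
  from this[of d] have "g (\<lambda>k. if k < d then h k else 0) = (\<Sum>k<d. g (\<lambda>l. of_bool (l = k)) * h k)" by simp
  moreover have "(\<lambda>k. if k < d then h k else 0) = h" using h by (auto simp: V_def)
  ultimately show ?thesis by (simp add: g_def algebra_simps)
qed

text \<open>Only the first row and the first column are filled, with negative entries allowed. The
  corner is chosen to correct row 0, and equality of the totals makes it correct column 0 as
  well.\<close>

lemma margins_realizable:
  fixes a b :: "nat \<Rightarrow> int"
  assumes "0 < s" "0 < t" "(\<Sum>i<t. a i) = (\<Sum>j<s. b j)"
  shows "\<exists>M. (\<forall>i<t. (\<Sum>j<s. M i j) = a i) \<and> (\<forall>j<s. (\<Sum>i<t. M i j) = b j)"
proof -
  obtain s' t' where st: "s = Suc s'" "t = Suc t'" using assms by (metis gr0_implies_Suc)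
  define M where "M i j = (if i = 0 then if j = 0 then a 0 - (\<Sum>j<s'. b (Suc j)) else b j
     else if j = 0 then a i else 0)" for i j
  have "(\<Sum>j<s. M i j) = a i" for i
    unfolding st sum.lessThan_Suc_shift by (simp add: M_def)
  moreover have "(\<Sum>i<t. M i j) = b j" if "j < s" for j
    using assms(3) unfolding st sum.lessThan_Suc_shift by (simp add: M_def)
  ultimately show ?thesis by blast
qed

section \<open>Table counts in an arbitrary lattice chart\<close>

context
  fixes s t d :: nat and T
  assumes st: "0 < s" "0 < t" and chart: "lattice_chart (transport_polytope s t) d T"
begin

private abbreviation "A \<equiv> margin_space s t"
private abbreviation "V \<equiv> {f :: nat \<Rightarrow> real. \<forall>i\<ge>d. f i = 0}"
private abbreviation "E \<equiv> {..<t} \<times> {..<s}"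

private definition "G = inv_into A T"
private definition "y0 = T (ones s t)"
text \<open>The coefficients of the linear part of the entry at the cell \<open>e\<close>, as a
  function of the chart coordinates.\<close>

private definition "D e k = G (\<lambda>l. y0 l + of_bool (l = k)) (fst e) (snd e) - G y0 (fst e) (snd e)"
text \<open>Translates between two models of real d-space: functions undefined from \<open>d\<close>
  on, used by the product measure, and functions zero from \<open>d\<close> on, used by the
  chart.\<close>

private definition "ext z = (\<lambda>k. if k < d then z k else (0::real))"

private lemma bij: "bij_betw T A V"
  using chart unfolding lattice_chart_def aff_span_transport_polytope by blast

private lemma bij_int: "bij_betw T (A \<inter> {M. int_matrix M}) {f. (\<forall>i\<ge>d. f i = 0) \<and> (\<forall>i. f i \<in> \<int>)}"
  using chart unfolding lattice_chart_def aff_span_transport_polytope by blast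

private lemma G_T: "X \<in> A \<Longrightarrow> G (T X) = X"
  unfolding G_def using bij by (rule bij_betw_inv_into_left)

private lemma T_G: "y \<in> V \<Longrightarrow> T (G y) = y"
  unfolding G_def using bij by (rule bij_betw_inv_into_right)

private lemma G_A: "y \<in> V \<Longrightarrow> G y \<in> A"
  unfolding G_def using bij_betw_inv_into[OF bij] by (rule bij_betw_apply)

private lemma T_V: "X \<in> A \<Longrightarrow> T X \<in> V"
  using bij by (rule bij_betw_apply)

private lemma T_int: assumes "X \<in> A" "int_matrix X" shows "T X k \<in> \<int>"
  using bij_betw_apply[OF bij_int, of X] assms by simp

private lemma G_int: assumes "y \<in> V" "\<And>i. y i \<in> \<int>" shows "int_matrix (G y)"
proof -
  have "y \<in> T ` (A \<inter> {M. int_matrix M})"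
    unfolding bij_betw_imp_surj_on[OF bij_int] using assms by simp
  then show ?thesis using G_T by auto
qed

private lemma y0_V: "y0 \<in> V"
  unfolding y0_def by (rule T_V[OF ones_margin_space])

private lemma y0_int: "y0 k \<in> \<int>"
  unfolding y0_def using ones_margin_space by (intro T_int) (auto simp: int_matrix_def ones_def)

text \<open>The constant 1 is the entry of the all-ones matrix at the base point \<open>y0\<close>.
  It turns nonnegativity of an entry into a half-space condition with offset 1.\<close>

private lemma G_coordinates:
  assumes "h \<in> V" "i < t" "j < s"
  shows "G (\<lambda>k. y0 k + h k) i j = 1 + (\<Sum>k<d. D (i, j) k * h k)"
proof -
  have aff: "T (\<lambda>i j. (1 - u) * x i j + u * y i j) = (\<lambda>k. (1 - u) * T x k + u * T y k)"
    if "x \<in> A" "y \<in> A" for x y u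
    using chart that unfolding lattice_chart_def aff_span_transport_polytope by blast
  have "G (\<lambda>k. (1 - u) * y k + u * y' k) = (\<lambda>i j. (1 - u) * G y i j + u * G y' i j)"
    if "y \<in> V" "y' \<in> V" for y y' u
    unfolding G_def by (rule affine_inverse[OF bij aff margin_space_affine that])
  from affine_coordinates[OF this y0_V assms(1), of "\<lambda>u y. y"]
  have "G (\<lambda>k. y0 k + h k) i j = G y0 i j + (\<Sum>k<d. D (i, j) k * h k)"
    by (simp add: D_def)
  moreover have "G y0 i j = 1"
    using assms G_T[OF ones_margin_space] by (simp add: y0_def ones_def)
  ultimately show ?thesis by simp
qed

interpretation half_spaces d E D by standard simp

private lemma ext_V: "ext z \<in> V" by (simp add: ext_def)

private lemma G_ext:
  assumes "e \<in> E"
  shows "G (\<lambda>k. y0 k + ext z k) (fst e) (snd e) = 1 + (\<Sum>k<d. D e k * z k)"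
  using G_coordinates[OF ext_V, of "fst e" "snd e" z] assms by (auto simp: ext_def)

private lemma y0_ext_V: "(\<lambda>k. y0 k + ext z k) \<in> V"
  using y0_V by (simp add: ext_def)

private lemma chart_image_iff:
  assumes x: "x \<in> Pi\<^sub>E {..<d} (\<lambda>_. UNIV)"
  shows "x \<in> (\<lambda>f. restrict f {..<d}) ` T ` transport_polytope s t \<longleftrightarrow>
    (\<forall>e\<in>E. - 1 \<le> (\<Sum>k<d. D e k * (x k - y0 k)))"
proof -
  have x_ext: "(\<lambda>k. y0 k + ext (\<lambda>k. x k - y0 k) k) = ext x"
    using y0_V by (auto simp: ext_def)
  have ext_restrict: "ext (restrict f {..<d}) = f" if "f \<in> V" for f
    using that by (auto simp: ext_def)
  have restrict_ext: "restrict (ext x) {..<d} = x"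
    using x by (auto simp: ext_def PiE_iff extensional_def)
  have *: "(\<forall>e\<in>E. 0 \<le> G (ext x) (fst e) (snd e)) \<longleftrightarrow> (\<forall>e\<in>E. - 1 \<le> (\<Sum>k<d. D e k * (x k - y0 k)))"
    using G_ext[of _ "\<lambda>k. x k - y0 k"] unfolding x_ext by (intro ball_cong) auto
  have "x \<in> (\<lambda>f. restrict f {..<d}) ` T ` transport_polytope s t \<longleftrightarrow>
     (\<forall>e\<in>E. 0 \<le> G (ext x) (fst e) (snd e))"
  proof
    assume "x \<in> (\<lambda>f. restrict f {..<d}) ` T ` transport_polytope s t"
    then obtain X where X: "X \<in> transport_polytope s t" "x = restrict (T X) {..<d}" by blast
    then have "X \<in> A" by (simp add: transport_polytope_iff)
    then have "G (ext x) = X"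
      using X(2) ext_restrict[OF T_V] G_T by simp
    then show "\<forall>e\<in>E. 0 \<le> G (ext x) (fst e) (snd e)"
      using X(1) by (auto simp: transport_polytope_iff)
  next
    assume nonneg: "\<forall>e\<in>E. 0 \<le> G (ext x) (fst e) (snd e)"
    have "0 \<le> G (ext x) i j" if "i < t" "j < s" for i j
      using bspec[OF nonneg, of "(i, j)"] that by simp
    then have "G (ext x) \<in> transport_polytope s t"
      using G_A[OF ext_V] by (simp add: transport_polytope_iff)
    moreover have "restrict (T (G (ext x))) {..<d} = x"
      using T_G[OF ext_V] restrict_ext by simp
    ultimately show "x \<in> (\<lambda>f. restrict f {..<d}) ` T ` transport_polytope s t"
      by (metis imageI)
  qed
  then show ?thesis using * by blast
qed

text \<open>The image of the polytope is the translate of \<open>region (\<lambda>_. 1)\<close> by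
  \<open>y0\<close>, and volume is translation invariant.\<close>

private lemma measure_chart_image:
  "measure M ((\<lambda>f. restrict f {..<d}) ` T ` transport_polytope s t) = measure M (region (\<lambda>_. 1))"
proof -
  let ?W = "(\<lambda>f. restrict f {..<d}) ` T ` transport_polytope s t"
  have W: "?W = {x \<in> space M. \<forall>e\<in>E. - 1 \<le> (\<Sum>k<d. D e k * (x k - y0 k))}"
  proof -
    have "?W \<subseteq> Pi\<^sub>E {..<d} (\<lambda>_. UNIV)"
      unfolding image_image by (rule image_subsetI) simp
    moreover have "W = {x \<in> U. Q x}" if "W \<subseteq> U" "\<And>x. x \<in> U \<Longrightarrow> x \<in> W \<longleftrightarrow> Q x"
      for W U :: "(nat \<Rightarrow> real) set" and Q
      using that by blast
    moreover have "space M = Pi\<^sub>E {..<d} (\<lambda>_. UNIV)" by (simp add: space_PiM)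
    ultimately show ?thesis using chart_image_iff by presburger
  qed
  have "finite E" by simp
  then have "{x \<in> space M. \<forall>e\<in>E. - 1 \<le> (\<Sum>k<d. D e k * (x k - y0 k))} \<in> sets M"
    by measurable
  then have "?W \<in> sets M" unfolding W .
  moreover have "{f \<in> space M. (\<lambda>i\<in>{..<d}. y0 i + 1 * f i) \<in> ?W} = region (\<lambda>_. 1)"
    unfolding W by (auto simp: region_def space_PiM)
  ultimately have "emeasure M ?W = emeasure M (region (\<lambda>_. 1))"
    using emeasure_PiM_lborel_affine[of 1 ?W d y0] by simp
  then show ?thesis by (simp add: measure_def)
qed

text \<open>Subtracting \<open>M0\<close> and n - 1 times the all-ones matrix from a table leaves an
  integral matrix in the margin space, whose chart coordinates relative to \<open>y0\<close> form a
  lattice point z. The table entry at e is n plus the \<open>M0\<close> entry plus the linear form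
  \<open>D e\<close> at z, so nonnegativity of the table is membership in the region.\<close>

private lemma card_tables_eq_lattice_count:
  fixes a b :: "nat \<Rightarrow> int" and M0 :: "nat \<Rightarrow> nat \<Rightarrow> int"
  assumes M0: "\<forall>i<t. (\<Sum>j<s. M0 i j) = a i" "\<forall>j<s. (\<Sum>i<t. M0 i j) = b j"
  shows "\<exists>f. bij_betw f (lattice \<inter> region (\<lambda>e. real n + of_int (M0 (fst e) (snd e))))
      (tables t s E (\<lambda>i. a i + int n * int s) (\<lambda>j. b j + int n * int t))"
proof -
  let ?R = "lattice \<inter> region (\<lambda>e. real n + of_int (M0 (fst e) (snd e)))"
  let ?tab = "tables t s E (\<lambda>i. a i + int n * int s) (\<lambda>j. b j + int n * int t)"
  \<comment> \<open>\<open>Y z\<close> is the matrix at the lattice point \<open>z\<close>, and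
    \<open>\<Phi>\<close> adds back what \<open>X\<close> subtracts. The floor in
    \<open>\<Phi>\<close> only converts real entries to integers: they are integral for lattice
    points.\<close>
  define Y where "Y z = G (\<lambda>k. y0 k + ext z k)" for z
  define \<Phi> where "\<Phi> z = (\<lambda>e. if e \<in> E then nat (\<lfloor>Y z (fst e) (snd e)\<rfloor> + M0 (fst e) (snd e) + int n - 1) else 0)" for z
  define X where "X N = (\<lambda>i j. if i < t \<and> j < s then real (N (i, j)) - of_int (M0 i j) - real n + 1 else 0)"
    for N :: "nat \<times> nat \<Rightarrow> nat"
  define \<Psi> where "\<Psi> N = (\<lambda>k\<in>{..<d}. T (X N) k - y0 k)" for N
  have YA: "Y z \<in> A" for z unfolding Y_def by (rule G_A[OF y0_ext_V])
  have Y_floor: "of_int \<lfloor>Y z i j\<rfloor> = Y z i j" if "z \<in> lattice" for z i j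
  proof -
    have "y0 k + ext z k \<in> \<int>" for k
      using that y0_int[of k] by (auto simp: ext_def lattice_def PiE_iff)
    then have "int_matrix (Y z)" unfolding Y_def by (intro G_int[OF y0_ext_V])
    then show ?thesis by (simp add: int_matrix_def)
  qed
  have \<Phi>: "real (\<Phi> z (i, j)) = Y z i j + of_int (M0 i j) + real n - 1"
    if z: "z \<in> ?R" and ij: "i < t" "j < s" for z i j
  proof -
    have "- (real n + of_int (M0 i j)) \<le> (\<Sum>k<d. D (i, j) k * z k)"
      using z ij by (force simp: region_def)
    then have "0 \<le> Y z i j + of_int (M0 i j) + real n - 1"
      using G_ext[of "(i, j)" z] ij by (simp add: Y_def)
    then have "0 \<le> real_of_int (\<lfloor>Y z i j\<rfloor> + M0 i j + int n - 1)"
      by (simp only: of_int_add of_int_diff of_int_1 of_int_of_nat_eq Y_floor[OF IntD1[OF z]])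
    then have "0 \<le> \<lfloor>Y z i j\<rfloor> + M0 i j + int n - 1" by (simp only: of_int_0_le_iff)
    then have "real (\<Phi> z (i, j)) = of_int (\<lfloor>Y z i j\<rfloor> + M0 i j + int n - 1)"
      using ij by (simp add: \<Phi>_def)
    then show ?thesis
      by (simp only: of_int_add of_int_diff of_int_1 of_int_of_nat_eq Y_floor[OF IntD1[OF z]])
  qed
  have X\<Phi>: "X (\<Phi> z) = Y z" if "z \<in> ?R" for z
    using \<Phi>[OF that] YA[of z] by (auto simp: X_def margin_space_def fun_eq_iff)
  have rows: "(\<Sum>j<s. real_of_int (M0 i j)) = of_int (a i)" if "i < t" for i
    using M0(1) that by (metis of_int_sum)
  have cols: "(\<Sum>i<t. real_of_int (M0 i j)) = of_int (b j)" if "j < s" for j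
    using M0(2) that by (metis of_int_sum)
  have XA: "X N \<in> A" if N: "N \<in> ?tab" for N
  proof -
    have "(\<Sum>j<s. X N i j) = real s" if i: "i < t" for i
    proof -
      have "(\<Sum>j<s. int (N (i, j))) = a i + int n * int s"
        using N i by (simp add: tables_def)
      from arg_cong[OF this, of real_of_int]
      have "(\<Sum>j<s. real (N (i, j))) = of_int (a i) + real n * real s" by simp
      moreover have "(\<Sum>j<s. X N i j) = (\<Sum>j<s. real (N (i, j)) - of_int (M0 i j) - real n + 1)"
        using i by (simp add: X_def)
      ultimately show ?thesis using rows[OF i] by (simp add: sum.distrib sum_subtractf mult.commute)
    qed
    moreover have "(\<Sum>i<t. X N i j) = real t" if j: "j < s" for j
    proof -
      have "(\<Sum>i<t. int (N (i, j))) = b j + int n * int t"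
        using N j by (simp add: tables_def)
      from arg_cong[OF this, of real_of_int]
      have "(\<Sum>i<t. real (N (i, j))) = of_int (b j) + real n * real t" by simp
      moreover have "(\<Sum>i<t. X N i j) = (\<Sum>i<t. real (N (i, j)) - of_int (M0 i j) - real n + 1)"
        using j by (simp add: X_def)
      ultimately show ?thesis using cols[OF j] by (simp add: sum.distrib sum_subtractf mult.commute)
    qed
    ultimately show ?thesis by (auto simp: margin_space_def X_def)
  qed
  have X_int: "int_matrix (X N)" for N
    by (auto simp: int_matrix_def X_def)
  have ext\<Psi>: "(\<lambda>k. y0 k + ext (\<Psi> N) k) = T (X N)" if "N \<in> ?tab" for N
    using T_V[OF XA[OF that]] y0_V by (auto simp: ext_def \<Psi>_def)
  have Y\<Psi>: "Y (\<Psi> N) = X N" if "N \<in> ?tab" for N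
    unfolding Y_def ext\<Psi>[OF that] by (rule G_T[OF XA[OF that]])
  have "bij_betw \<Phi> ?R ?tab"
  proof (rule bij_betw_byWitness[where f' = \<Psi>])
    show "\<forall>z\<in>?R. \<Psi> (\<Phi> z) = z"
    proof
      fix z assume z: "z \<in> ?R"
      have "T (X (\<Phi> z)) = (\<lambda>k. y0 k + ext z k)"
        unfolding X\<Phi>[OF z] Y_def by (rule T_G[OF y0_ext_V])
      then show "\<Psi> (\<Phi> z) = z"
        using z by (auto simp: \<Psi>_def ext_def lattice_def PiE_iff extensional_def)
    qed
    show "\<forall>N\<in>?tab. \<Phi> (\<Psi> N) = N"
    proof
      fix N assume N: "N \<in> ?tab"
      have "\<Phi> (\<Psi> N) (i, j) = N (i, j)" for i j
      proof (cases "i < t \<and> j < s")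
        case True
        then have "X N i j = of_int (int (N (i, j)) - M0 i j - int n + 1)" by (simp add: X_def)
        then have "\<lfloor>X N i j\<rfloor> = int (N (i, j)) - M0 i j - int n + 1" by (metis floor_of_int)
        then show ?thesis using True Y\<Psi>[OF N] by (simp add: \<Phi>_def)
      next
        case False
        then show ?thesis using N by (auto simp: \<Phi>_def tables_def)
      qed
      then show "\<Phi> (\<Psi> N) = N" by auto
    qed
    show "\<Phi> ` ?R \<subseteq> ?tab"
    proof (rule image_subsetI)
      fix z assume z: "z \<in> ?R"
      have "(\<Sum>j<s. int (\<Phi> z (i, j))) = a i + int n * int s" if i: "i < t" for i
      proof -
        have "(\<Sum>j<s. real (\<Phi> z (i, j))) = (\<Sum>j<s. Y z i j + of_int (M0 i j) + real n - 1)"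
          using \<Phi>[OF z i] by simp
        also have "\<dots> = of_int (a i + int n * int s)"
          using YA[of z] i rows[OF i] by (simp add: margin_space_def sum.distrib sum_subtractf)
        finally have "real_of_int (\<Sum>j<s. int (\<Phi> z (i, j))) = of_int (a i + int n * int s)" by simp
        then show ?thesis by (simp only: of_int_eq_iff)
      qed
      moreover have "(\<Sum>i<t. int (\<Phi> z (i, j))) = b j + int n * int t" if j: "j < s" for j
      proof -
        have "(\<Sum>i<t. real (\<Phi> z (i, j))) = (\<Sum>i<t. Y z i j + of_int (M0 i j) + real n - 1)"
          using \<Phi>[OF z _ j] by simp
        also have "\<dots> = of_int (b j + int n * int t)"
          using YA[of z] j cols[OF j] by (simp add: margin_space_def sum.distrib sum_subtractf)
        finally have "real_of_int (\<Sum>i<t. int (\<Phi> z (i, j))) = of_int (b j + int n * int t)" by simp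
        then show ?thesis by (simp only: of_int_eq_iff)
      qed
      ultimately show "\<Phi> z \<in> ?tab" by (auto simp: tables_def \<Phi>_def)
    qed
    show "\<Psi> ` ?tab \<subseteq> ?R"
    proof (rule image_subsetI)
      fix N assume N: "N \<in> ?tab"
      have "T (X N) k - y0 k \<in> \<int>" for k
        using T_int[OF XA[OF N] X_int] y0_int by (rule Ints_diff)
      then have "\<Psi> N \<in> lattice" by (auto simp: \<Psi>_def lattice_def)
      moreover have "- (real n + of_int (M0 (fst e) (snd e))) \<le> (\<Sum>k<d. D e k * \<Psi> N k)" if e: "e \<in> E" for e
        using G_ext[OF e, of "\<Psi> N"] Y\<Psi>[OF N] e unfolding Y_def by (auto simp: X_def)
      moreover have "\<Psi> N \<in> Pi\<^sub>E {..<d} (\<lambda>_. UNIV)" by (simp add: \<Psi>_def)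
      ultimately show "\<Psi> N \<in> ?R" unfolding region_def by blast
    qed
  qed
  then show ?thesis by blast
qed

text \<open>The chart and its dimension are left open. Since the left side depends on the chart only
  through \<open>d\<close>, this will identify the dimensions and volumes obtained from different
  charts.\<close>

lemma card_tables_asymptotics:
  fixes a b :: "nat \<Rightarrow> int"
  assumes ab: "(\<Sum>i<t. a i) = (\<Sum>j<s. b j)"
  defines "v \<equiv> measure (\<Pi>\<^sub>M i\<in>{..<d}. lborel) ((\<lambda>f. restrict f {..<d}) ` T ` transport_polytope s t)"
  shows "(\<lambda>n. real (card (tables t s ({..<t} \<times> {..<s}) (\<lambda>i. a i + int n * int s) (\<lambda>j. b j + int n * int t)))
      / real n ^ d) \<longlonglongrightarrow> v" and "0 < v"
proof -
  obtain M0 where M0: "\<forall>i<t. (\<Sum>j<s. M0 i j) = a i" "\<forall>j<s. (\<Sum>i<t. M0 i j) = b j"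
    using margins_realizable[OF st ab] by blast
  let ?m = "\<lambda>e. real_of_int (M0 (fst e) (snd e))"
  have card_eq: "card (lattice \<inter> region (\<lambda>e. real n + ?m e)) =
      card (tables t s E (\<lambda>i. a i + int n * int s) (\<lambda>j. b j + int n * int t))"
    and fin: "finite (lattice \<inter> region (\<lambda>e. real n + ?m e))" for n
  proof -
    obtain f where f: "bij_betw f (lattice \<inter> region (\<lambda>e. real n + ?m e))
        (tables t s E (\<lambda>i. a i + int n * int s) (\<lambda>j. b j + int n * int t))"
      using card_tables_eq_lattice_count[OF M0] by blast
    show "card (lattice \<inter> region (\<lambda>e. real n + ?m e)) =
        card (tables t s E (\<lambda>i. a i + int n * int s) (\<lambda>j. b j + int n * int t))"
      using f by (rule bij_betw_same_card)
    show "finite (lattice \<inter> region (\<lambda>e. real n + ?m e))"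
      using bij_betw_finite[OF f] finite_tables by simp
  qed
  have v: "v = measure M (region (\<lambda>_. 1))"
    unfolding v_def by (rule measure_chart_image)
  show "(\<lambda>n. real (card (tables t s E (\<lambda>i. a i + int n * int s) (\<lambda>j. b j + int n * int t))) / real n ^ d) \<longlonglongrightarrow> v"
    using lattice_count_asymptotics(1)[OF fin] unfolding v card_eq .
  show "0 < v"
    unfolding v by (rule lattice_count_asymptotics(2)[OF fin])
qed

end

section \<open>Growth rates, degrees and leading coefficients\<close>

lemma poly_over_power_tendsto_lead_coeff:
  fixes p :: "real poly"
  shows "(\<lambda>n. poly p (real n) / real n ^ degree p) \<longlonglongrightarrow> lead_coeff p"
proof -
  have "(\<lambda>n. coeff p i * (real n ^ i / real n ^ degree p)) \<longlonglongrightarrow> (if i = degree p then lead_coeff p else 0)"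
    if "i \<le> degree p" for i
  proof (cases "i = degree p")
    case True
    have "\<forall>\<^sub>F n in sequentially. lead_coeff p = coeff p i * (real n ^ i / real n ^ degree p)"
      using eventually_gt_at_top[of "0::nat"] True by (auto elim!: eventually_mono)
    then have "(\<lambda>n. coeff p i * (real n ^ i / real n ^ degree p)) \<longlonglongrightarrow> lead_coeff p"
      by (rule Lim_transform_eventually[OF tendsto_const])
    then show ?thesis using True by simp
  next
    case False
    then have "i < degree p" using that by simp
    then obtain k where k: "degree p = i + Suc k" by (auto simp: less_iff_Suc_add)
    have "(\<lambda>n. coeff p i * (1 / real n) ^ Suc k) \<longlonglongrightarrow> coeff p i * 0 ^ Suc k"
      by (intro tendsto_intros lim_1_over_n)
    moreover have "\<forall>\<^sub>F n in sequentially. coeff p i * (1 / real n) ^ Suc k = coeff p i * (real n ^ i / real n ^ degree p)"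
      using eventually_gt_at_top[of "0::nat"]
      by eventually_elim (simp add: k power_add field_simps)
    ultimately have "(\<lambda>n. coeff p i * (real n ^ i / real n ^ degree p)) \<longlonglongrightarrow> coeff p i * 0 ^ Suc k"
      by (rule Lim_transform_eventually)
    then show ?thesis using False by simp
  qed
  then have "(\<lambda>n. \<Sum>i\<le>degree p. coeff p i * (real n ^ i / real n ^ degree p))
      \<longlonglongrightarrow> (\<Sum>i\<le>degree p. if i = degree p then lead_coeff p else 0)"
    by (intro tendsto_sum) auto
  moreover have eq: "(\<Sum>i\<le>degree p. coeff p i * (real n ^ i / real n ^ degree p)) = poly p (real n) / real n ^ degree p" for n
    by (simp add: poly_altdef sum_divide_distrib)
  ultimately show ?thesis unfolding eq by simp
qed

text \<open>With a larger exponent \<open>d'\<close>, the second quotient would be the first one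
  times a negative power of n and tend to 0.\<close>

lemma growth_exponent_le:
  fixes f :: "nat \<Rightarrow> real"
  assumes "(\<lambda>n. f n / real n ^ d) \<longlonglongrightarrow> v" "(\<lambda>n. f n / real n ^ d') \<longlonglongrightarrow> v'" "v' \<noteq> 0"
  shows "d' \<le> d"
proof (rule ccontr)
  assume "\<not> d' \<le> d"
  then have "d < d'" by simp
  then obtain k where k: "d' = d + Suc k" by (auto simp: less_iff_Suc_add)
  have "(\<lambda>n. (1 / real n) ^ Suc k * (f n / real n ^ d)) \<longlonglongrightarrow> 0 ^ Suc k * v"
    by (intro tendsto_intros lim_1_over_n assms(1))
  moreover have "\<forall>\<^sub>F n in sequentially. (1 / real n) ^ Suc k * (f n / real n ^ d) = f n / real n ^ d'"
    using eventually_gt_at_top[of "0::nat"]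
    by eventually_elim (simp add: k power_add field_simps)
  ultimately have "(\<lambda>n. f n / real n ^ d') \<longlonglongrightarrow> 0 ^ Suc k * v"
    by (rule Lim_transform_eventually)
  then have "(\<lambda>n. f n / real n ^ d') \<longlonglongrightarrow> 0" by simp
  then show False using assms(2,3) LIMSEQ_unique by blast
qed

text \<open>Serves twice: to compare two charts, and to compare the degree of the counting
  polynomial with the dimension.\<close>

lemma growth_unique:
  fixes f :: "nat \<Rightarrow> real"
  assumes "(\<lambda>n. f n / real n ^ d) \<longlonglongrightarrow> v" "(\<lambda>n. f n / real n ^ d') \<longlonglongrightarrow> v'" "v \<noteq> 0" "v' \<noteq> 0"
  shows "d = d' \<and> v = v'"
proof -
  have "d = d'" using growth_exponent_le assms by (metis le_antisym)
  then show ?thesis using assms LIMSEQ_unique by blast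
qed

lemma poly_degree_lead_coeff:
  assumes "\<forall>\<^sub>F n in sequentially. f n = poly p (real n)" "(\<lambda>n. f n / real n ^ d) \<longlonglongrightarrow> v" "v \<noteq> 0"
  shows "degree p = d \<and> lead_coeff p = v"
proof -
  have *: "(\<lambda>n. poly p (real n) / real n ^ d) \<longlonglongrightarrow> v"
  proof (rule Lim_transform_eventually[OF assms(2)])
    show "\<forall>\<^sub>F n in sequentially. f n / real n ^ d = poly p (real n) / real n ^ d"
      using assms(1) by eventually_elim simp
  qed
  have "p \<noteq> 0"
  proof
    assume "p = 0"
    then have "(\<lambda>n. 0) \<longlonglongrightarrow> v" using * by simp
    then show False using assms(3) LIMSEQ_unique[OF _ tendsto_const] by blast
  qed
  then have "lead_coeff p \<noteq> 0" by simp
  from growth_unique[OF poly_over_power_tendsto_lead_coeff * this assms(3)] show ?thesis .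
qed

lemma mult_add_less: "i < t \<Longrightarrow> j < s \<Longrightarrow> i * s + j < t * (s::nat)"
  by (metis Suc_leI add.commute add_le_mono1 less_le_trans mult_Suc mult_le_mono1 nat_add_left_cancel_less)

text \<open>The chart keeps the entries outside the last row and the last column, which determine the rest.\<close>

lemma lattice_chart_exists:
  assumes "0 < s" "0 < t"
  shows "\<exists>T. lattice_chart (transport_polytope s t) ((s - 1) * (t - 1)) T"
proof -
  obtain s' t' where st: "s = Suc s'" "t = Suc t'" using assms by (metis gr0_implies_Suc)
  let ?d = "(s - 1) * (t - 1)"
  have d: "?d = t' * s'" by (simp add: st)
  define T where "T X k = (if k < t' * s' then X (k div s') (k mod s') else 0)"
    for X :: "nat \<Rightarrow> nat \<Rightarrow> real" and k
  define R where "R y i = real s - (\<Sum>j<s'. y (i * s' + j))" for y :: "nat \<Rightarrow> real" and i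
  define C where "C y j = real t - (\<Sum>i<t'. y (i * s' + j))" for y :: "nat \<Rightarrow> real" and j
  \<comment> \<open>\<open>R\<close> and \<open>C\<close> complete the first rows and columns. The
    corner completes the last row; it also completes the last column because both kinds of margins
    add up to st.\<close>
  define G where "G y i j = (if i < t' \<and> j < s' then y (i * s' + j)
     else if i < t' \<and> j = s' then R y i else if i = t' \<and> j < s' then C y j
     else if i = t' \<and> j = s' then real s - (\<Sum>j<s'. C y j) else 0)" for y i j
  have G_margin: "G y \<in> margin_space s t" for y
  proof -
    have "(\<Sum>j<s. G y i j) = real s" if "i < t" for i
      using that by (auto simp: st less_Suc_eq G_def R_def)
    moreover have "(\<Sum>i<t. G y i j) = real t" if "j < s" for j
    proof (cases "j < s'")
      case True
      then show ?thesis by (simp add: st G_def C_def)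
    next
      case False
      then have "j = s'" using that st by simp
      have "(\<Sum>i<t'. R y i) + (real s - (\<Sum>j<s'. C y j)) = real t"
        unfolding R_def C_def sum_subtractf using sum.swap[of "\<lambda>i j. y (i * s' + j)" "{..<s'}" "{..<t'}"]
        by (simp add: st algebra_simps)
      then show ?thesis by (simp add: st G_def \<open>j = s'\<close>)
    qed
    ultimately show ?thesis by (auto simp: margin_space_def G_def st)
  qed
  have TG: "T (G y) = y" if "\<forall>k\<ge>?d. y k = 0" for y
  proof
    fix k
    show "T (G y) k = y k"
    proof (cases "k < t' * s'")
      case True
      then have "s' > 0" by (cases s') auto
      then have "k div s' < t'" "k mod s' < s'" using True by (auto simp: less_mult_imp_div_less)
      then show ?thesis using True by (simp add: T_def G_def)
    next
      case False
      then show ?thesis using that d by (simp add: T_def)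
    qed
  qed
  have GT: "G (T X) = X" if X: "X \<in> margin_space s t" for X
  proof -
    have T: "T X (i * s' + j) = X i j" if "i < t'" "j < s'" for i j
      using mult_add_less[OF that] that by (simp add: T_def)
    have row: "(\<Sum>j<s'. X i j) + X i s' = real s" if "i < t" for i
      using X that by (auto simp: margin_space_def st)
    have col: "(\<Sum>i<t'. X i j) + X t' j = real t" if "j < s" for j
      using X that by (auto simp: margin_space_def st)
    have "R (T X) i = X i s'" if "i < t'" for i
      using row[of i] that by (simp add: R_def T st)
    moreover have C: "C (T X) j = X t' j" if "j < s'" for j
      using col[of j] that by (simp add: C_def T st)
    moreover have "real s - (\<Sum>j<s'. C (T X) j) = X t' s'"
      using row[of t'] C by (simp add: st)
    moreover have "X i j = 0" if "t \<le> i \<or> s \<le> j" for i j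
      using X that by (auto simp: margin_space_def)
    ultimately show ?thesis by (intro ext) (auto simp: G_def T st)
  qed
  have T_V: "\<forall>k\<ge>?d. T X k = 0" for X unfolding d by (simp add: T_def)
  have "bij_betw T (margin_space s t) {f. \<forall>i\<ge>?d. f i = 0}"
    by (rule bij_betw_byWitness[where f' = G]) (use TG GT T_V G_margin in blast)+
  moreover have "bij_betw T (margin_space s t \<inter> {X. int_matrix X}) {f. (\<forall>i\<ge>?d. f i = 0) \<and> (\<forall>i. f i \<in> \<int>)}"
  proof (rule bij_betw_byWitness[where f' = G])
    have "T X k \<in> \<int>" if "int_matrix X" for X k using that by (simp add: T_def int_matrix_def)
    then show "T ` (margin_space s t \<inter> {X. int_matrix X}) \<subseteq> {f. (\<forall>i\<ge>?d. f i = 0) \<and> (\<forall>i. f i \<in> \<int>)}"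
      using T_V by blast
    have "int_matrix (G y)" if "\<forall>i. y i \<in> \<int>" for y
      using that by (auto simp: int_matrix_def G_def R_def C_def intro!: Ints_diff Ints_sum)
    then show "G ` {f. (\<forall>i\<ge>?d. f i = 0) \<and> (\<forall>i. f i \<in> \<int>)} \<subseteq> margin_space s t \<inter> {X. int_matrix X}"
      using G_margin by blast
  qed (use TG GT in blast)+
  moreover have "T (\<lambda>i j. (1 - u) * x i j + u * y i j) = (\<lambda>k. (1 - u) * T x k + u * T y k)" for x y u
    by (simp add: T_def fun_eq_iff)
  ultimately show ?thesis
    unfolding lattice_chart_def aff_span_transport_polytope by blast
qed

text \<open>\<open>rel_volume\<close> selects an unknown chart of unknown dimension. The explicit
  chart shows that there is something to select, and uniqueness of the growth rate forces the
  selected chart to have dimension \<open>(s - 1) * (t - 1)\<close>.\<close>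

lemma card_tables_tendsto_rel_volume:
  fixes a b :: "nat \<Rightarrow> int"
  assumes st: "0 < s" "0 < t" and ab: "(\<Sum>i<t. a i) = (\<Sum>j<s. b j)"
  shows "(\<lambda>n. real (card (tables t s ({..<t} \<times> {..<s}) (\<lambda>i. a i + int n * int s) (\<lambda>j. b j + int n * int t)))
      / real n ^ ((s - 1) * (t - 1))) \<longlonglongrightarrow> rel_volume (transport_polytope s t)"
    and "0 < rel_volume (transport_polytope s t)"
proof -
  let ?f = "\<lambda>n. real (card (tables t s ({..<t} \<times> {..<s}) (\<lambda>i. a i + int n * int s) (\<lambda>j. b j + int n * int t)))"
  let ?v = "rel_volume (transport_polytope s t)"
  obtain T where T: "lattice_chart (transport_polytope s t) ((s - 1) * (t - 1)) T"
    using lattice_chart_exists[OF st] by blast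
  then have "\<exists>v d T. lattice_chart (transport_polytope s t) d T \<and>
      v = measure (PiM {..<d} (\<lambda>_. lborel)) ((\<lambda>f. restrict f {..<d}) ` T ` transport_polytope s t)"
    by blast
  from someI_ex[OF this] obtain d' T' where T': "lattice_chart (transport_polytope s t) d' T'"
    and v: "?v = measure (PiM {..<d'} (\<lambda>_. lborel)) ((\<lambda>f. restrict f {..<d'}) ` T' ` transport_polytope s t)"
    unfolding rel_volume_def by blast
  note lim = card_tables_asymptotics[OF st T ab] and lim' = card_tables_asymptotics[OF st T' ab, folded v]
  have "(s - 1) * (t - 1) = d'"
    using growth_unique[OF lim(1) lim'(1)] lim(2) lim'(2) by simp
  then show "(\<lambda>n. ?f n / real n ^ ((s - 1) * (t - 1))) \<longlonglongrightarrow> ?v" using lim'(1) by simp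
  show "0 < ?v" by (rule lim'(2))
qed

lemma card_tables_polynomial:
  fixes a b :: "nat \<Rightarrow> int"
  assumes "0 < s" "0 < t" "coprime s t" and "(\<Sum>i<t. a i) = (\<Sum>j<s. b j)"
  shows "\<exists>p. degree p = (s - 1) * (t - 1) \<and> lead_coeff p = rel_volume (transport_polytope s t) \<and>
    (\<forall>\<^sub>F n in sequentially. real (card (tables t s ({..<t} \<times> {..<s}) (\<lambda>i. a i + int n * int s) (\<lambda>j. b j + int n * int t)))
      = poly p (real n))"
proof -
  obtain p where p: "\<forall>\<^sub>F n in sequentially. real (card (tables t s ({..<t} \<times> {..<s}) (\<lambda>i. a i + int n * int s) (\<lambda>j. b j + int n * int t)))
      = poly p (real n)"
    using evpoly_card_tables_line[OF order_refl assms(1-3)] unfolding evpoly_def by blast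
  have "rel_volume (transport_polytope s t) \<noteq> 0"
    using card_tables_tendsto_rel_volume(2)[OF assms(1,2,4)] by simp
  from poly_degree_lead_coeff[OF p card_tables_tendsto_rel_volume(1)[OF assms(1,2,4)] this] p
  show ?thesis by blast
qed

section \<open>Beta numbers, rim hooks and cores\<close>

definition row_length :: "nat list \<Rightarrow> nat \<Rightarrow> nat" where
  "row_length p i = (if i < length p then p ! i else 0)"

text \<open>The beta number of row \<open>i\<close> when the partition is padded to \<open>k\<close>
  rows. The padding rows give the beads 0, 1, 2 and so on from the bottom.\<close>

definition bead :: "nat \<Rightarrow> (nat \<Rightarrow> nat) \<Rightarrow> nat \<Rightarrow> nat" where
  "bead k f i = f i + (k - 1 - i)"

definition beta :: "nat \<Rightarrow> (nat \<Rightarrow> nat) \<Rightarrow> nat set" where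
  "beta k f = bead k f ` {..<k}"

definition shape :: "nat \<Rightarrow> (nat \<Rightarrow> nat) \<Rightarrow> bool" where
  "shape k f \<longleftrightarrow> antimono f \<and> (\<forall>i\<ge>k. f i = 0)"

lemma shapeD: "shape k f \<Longrightarrow> i \<le> j \<Longrightarrow> f j \<le> f i" "shape k f \<Longrightarrow> k \<le> i \<Longrightarrow> f i = 0"
  by (auto simp: shape_def antimono_def)

lemma shape_row_length: assumes "is_partition p" "length p \<le> k" shows "shape k (row_length p)"
proof -
  have "row_length p j \<le> row_length p i" if "i \<le> j" for i j
    using assms(1) that unfolding is_partition_def row_length_def
    by (cases "i = j") (auto simp: sorted_wrt_iff_nth_less)
  then show ?thesis using assms(2) by (auto simp: shape_def antimono_def row_length_def)
qed

lemma cells_row_length: "cells p = {(i, j). j < row_length p i}"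
  by (auto simp: cells_def row_length_def split: if_splits)

lemma row_length_pos_iff: "is_partition p \<Longrightarrow> 0 < row_length p i \<longleftrightarrow> i < length p"
  by (auto simp: row_length_def is_partition_def)

lemma partition_eqI:
  assumes "is_partition p" "is_partition q" "row_length p = row_length q" shows "p = q"
proof -
  have "i < length p \<longleftrightarrow> i < length q" for i
    using assms row_length_pos_iff by metis
  then have l: "length p = length q" by (metis nat_neq_iff)
  show ?thesis
  proof (rule nth_equalityI[OF l])
    fix i assume "i < length p"
    then show "p ! i = q ! i" using fun_cong[OF assms(3), of i] l by (simp add: row_length_def)
  qed
qed

lemma partition_of_shape:
  assumes "shape k f" shows "\<exists>p. is_partition p \<and> length p \<le> k \<and> row_length p = f"
proof -
  define m where "m = (LEAST i. f i = 0)"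
  have fk: "f k = 0" using assms by (simp add: shape_def)
  have m: "f m = 0" "m \<le> k" unfolding m_def using fk by (auto intro: LeastI Least_le)
  have pos: "0 < f i" if "i < m" for i using that not_less_Least unfolding m_def by blast
  have "is_partition (map f [0..<m])"
    using pos shapeD(1)[OF assms] by (auto simp: is_partition_def sorted_wrt_iff_nth_less)
  moreover have "row_length (map f [0..<m]) = f"
    using shapeD(1)[OF assms, of m] m(1) by (fastforce simp: row_length_def)
  ultimately show ?thesis using m(2) by (intro exI[of _ "map f [0..<m]"]) simp
qed

lemma bead_less: assumes "shape k f" "i < j" "j < k" shows "bead k f j < bead k f i"
  using shapeD(1)[OF assms(1), of i j] assms(2,3) by (simp add: bead_def)

lemma bead_le_iff: assumes "shape k f" "i < k" "j < k" shows "bead k f j \<le> bead k f i \<longleftrightarrow> i \<le> j"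
  using bead_less[OF assms(1), of i j] bead_less[OF assms(1), of j i] assms(2,3)
  by (metis le_less_linear less_imp_le_nat not_le order_le_less)

lemma inj_bead: assumes "shape k f" shows "inj_on (bead k f) {..<k}"
  using bead_le_iff[OF assms] by (intro inj_onI) (metis lessThan_iff le_antisym order_refl)

lemma finite_beta [simp]: "finite (beta k f)" by (simp add: beta_def)

lemma card_beta: "shape k f \<Longrightarrow> card (beta k f) = k"
  unfolding beta_def by (simp add: card_image inj_bead)

text \<open>Beads strictly decrease with the row, so the set of beads alone tells which row a bead
  belongs to.\<close>

lemma card_larger_beads:
  assumes "shape k f" "i < k" shows "card {x \<in> beta k f. bead k f i < x} = i"
proof -
  have "{x \<in> beta k f. bead k f i < x} = bead k f ` {..<i}"
    using bead_le_iff[OF assms(1)] assms(2) by (auto simp: beta_def not_le[symmetric])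
  moreover have "inj_on (bead k f) {..<i}"
    using inj_bead[OF assms(1)] assms(2) by (auto elim: inj_on_subset)
  ultimately show ?thesis by (simp add: card_image)
qed

lemma beta_inject:
  assumes f: "shape k f" and g: "shape k g" and eq: "beta k f = beta k g"
  shows "f = g"
proof
  fix i
  show "f i = g i"
  proof (cases "i < k")
    case True
    then have "bead k g i \<in> beta k f" using eq by (auto simp: beta_def)
    then obtain j where j: "j < k" "bead k g i = bead k f j" by (auto simp: beta_def)
    have "i = j"
      using card_larger_beads[OF f j(1)] card_larger_beads[OF g True] eq j(2) by simp
    then show ?thesis using j(2) by (simp add: bead_def)
  next
    case False
    then show ?thesis using f g by (simp add: shape_def)
  qed
qed

lemma strict_sorted_nth_gap:
  assumes "sorted_wrt (<) (xs :: nat list)" "i \<le> j" "j < length xs"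
  shows "xs ! i + (j - i) \<le> xs ! j"
  using assms(2,3)
proof (induction j rule: dec_induct)
  case (step j)
  have "xs ! j < xs ! Suc j" using assms(1) step.prems by (simp add: sorted_wrt_iff_nth_less)
  then show ?case using step by simp
qed simp

text \<open>Sort the set and subtract the staircase 0, 1, ..., k - 1. The list is increasing while
  rows decrease, hence the index \<open>k - 1 - i\<close>.\<close>

lemma shape_of_beta:
  assumes "finite B" "card B = k" shows "\<exists>f. shape k f \<and> beta k f = B"
proof -
  define xs where "xs = sorted_list_of_set B"
  have xs: "sorted_wrt (<) xs" "length xs = k" "set xs = B"
    using assms by (auto simp: xs_def)
  have ge: "i \<le> xs ! i" if "i < k" for i
    using strict_sorted_nth_gap[OF xs(1), of 0 i] that xs(2) by simp
  define f where "f i = (if i < k then xs ! (k - 1 - i) - (k - 1 - i) else 0)" for i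
  have "f j \<le> f i" if "i \<le> j" for i j
  proof (cases "j < k")
    case True
    then have "xs ! (k - 1 - j) + ((k - 1 - i) - (k - 1 - j)) \<le> xs ! (k - 1 - i)"
      using that xs(2) by (intro strict_sorted_nth_gap[OF xs(1)]) auto
    then show ?thesis using True that by (simp add: f_def)
  qed (simp add: f_def)
  then have "shape k f" by (auto simp: shape_def antimono_def f_def)
  moreover have "beta k f = B"
  proof -
    have "bead k f i = xs ! (k - 1 - i)" if "i < k" for i
      using ge[of "k - 1 - i"] that by (simp add: bead_def f_def)
    then have "beta k f = (\<lambda>i. xs ! (k - 1 - i)) ` {..<k}" by (simp add: beta_def)
    also have "\<dots> = (\<lambda>i. xs ! i) ` (\<lambda>i. k - 1 - i) ` {..<k}" by (simp add: image_image)
    also have "(\<lambda>i. k - 1 - i) ` {..<k} = {..<k}"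
    proof (intro equalityI subsetI)
      fix i assume "i \<in> {..<k}"
      then show "i \<in> (\<lambda>i. k - 1 - i) ` {..<k}" by (intro image_eqI[of _ _ "k - 1 - i"]) auto
    qed auto
    finally show ?thesis using xs by (auto simp: set_conv_nth)
  qed
  ultimately show ?thesis by blast
qed

text \<open>The gap \<open>y\<close> corresponds to the column \<open>y + m - k\<close>, of height \<open>m\<close>, and the hook of row \<open>i\<close> in
  that column has length \<open>bead k f i - y\<close>.\<close>

lemma gap_position:
  assumes f: "shape k f" and i: "i < k" and y: "y < bead k f i" "y \<notin> beta k f"
  obtains m where "i < m" "m \<le> k" "k \<le> y + m" "y + m - k < f (m - 1)" "f m \<le> y + m - k"
proof -
  \<comment> \<open>The first row whose bead lies below the gap \<open>y\<close>, or
    \<open>k\<close> if there is none; so \<open>m\<close> counts the beads above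
    \<open>y\<close>.\<close>
  define m where "m = (LEAST m. m = k \<or> bead k f m < y)"
  have m: "m = k \<or> bead k f m < y" unfolding m_def by (rule LeastI[of _ k]) simp
  have "m \<le> k" unfolding m_def by (rule Least_le) simp
  have before: "y < bead k f l" if "l < m" for l
  proof -
    have "l < k" "\<not> bead k f l < y" using that \<open>m \<le> k\<close> not_less_Least unfolding m_def by auto
    moreover from this have "bead k f l \<noteq> y" using y(2) by (auto simp: beta_def)
    ultimately show ?thesis by simp
  qed
  have "i < m"
  proof (rule ccontr)
    assume "\<not> i < m"
    then have "m \<le> i" "m < k" using i by auto
    then have "bead k f i \<le> bead k f m" using bead_le_iff[OF f] i by blast
    then show False using m y(1) \<open>m < k\<close> by simp
  qed
  moreover have "k \<le> y + m" "f m \<le> y + m - k"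
    using m \<open>m \<le> k\<close> shapeD(2)[OF f, of k] by (auto simp: bead_def)
  moreover have "y + m - k < f (m - 1)"
    using before[of "m - 1"] \<open>i < m\<close> \<open>m \<le> k\<close> \<open>k \<le> y + m\<close> by (simp add: bead_def)
  ultimately show ?thesis using \<open>m \<le> k\<close> that by blast
qed

lemma hook_length_eq:
  assumes p: "is_partition p" "length p \<le> k" and cell: "i < m" "m \<le> k" "j < row_length p (m - 1)" "row_length p m \<le> j"
  shows "(i, j) \<in> cells p" "hook_length p i j + (j + k) = bead k (row_length p) i + m"
proof -
  let ?f = "row_length p"
  have f: "shape k ?f" using p by (rule shape_row_length)
  have j: "j < ?f l \<longleftrightarrow> l < m" for l
  proof (cases "l < m")
    case True
    then have "l \<le> m - 1" by simp
    then show ?thesis using shapeD(1)[OF f, of l "m - 1"] cell(3) True by simp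
  next
    case False
    then show ?thesis using shapeD(1)[OF f, of m l] cell(4) by simp
  qed
  then have ji: "j < ?f i" using cell(1) by simp
  then show "(i, j) \<in> cells p" by (simp add: cells_row_length)
  have lm: "l < length p \<and> j < p ! l \<longleftrightarrow> l < m" for l
    using j[of l] by (simp add: row_length_def split: if_splits)
  have "{l. i < l \<and> l < length p \<and> j < p ! l} = {i<..<m}"
    unfolding lm by auto
  then have "card {l. i < l \<and> l < length p \<and> j < p ! l} = m - i - 1" by simp
  moreover have "p ! i = ?f i" using ji by (auto simp: row_length_def split: if_splits)
  ultimately show "hook_length p i j + (j + k) = bead k ?f i + m"
    using ji cell(1,2) by (simp add: hook_length_def bead_def)
qed

text \<open>On an abacus with \<open>t\<close> runners, one for each residue class, all beads are
  pushed to the start of their runner.\<close>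

definition flush :: "nat \<Rightarrow> nat set \<Rightarrow> bool" where
  "flush t B \<longleftrightarrow> (\<forall>x\<in>B. t \<le> x \<longrightarrow> x - t \<in> B)"

text \<open>A hook of length \<open>t\<close> amounts to a bead \<open>x\<close> with a gap at
  \<open>x - t\<close>.\<close>

lemma is_core_iff_flush:
  assumes p: "is_partition p" "length p \<le> k" and "0 < t"
  shows "is_core t p \<longleftrightarrow> flush t (beta k (row_length p))"
proof
  let ?f = "row_length p"
  have f: "shape k ?f" using p by (rule shape_row_length)
  assume core: "is_core t p"
  show "flush t (beta k ?f)"
    unfolding flush_def
  proof (intro ballI impI, rule ccontr)
    fix x assume x: "x \<in> beta k ?f" "t \<le> x" "x - t \<notin> beta k ?f"
    then obtain i where i: "i < k" "x = bead k ?f i" by (auto simp: beta_def)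
    obtain m where m: "i < m" "m \<le> k" "k \<le> x - t + m" "x - t + m - k < ?f (m - 1)" "?f m \<le> x - t + m - k"
      using gap_position[OF f i(1) _ x(3)] x(2) i(2) \<open>0 < t\<close> by (metis diff_less less_le_trans)
    note h = hook_length_eq[OF p m(1,2,4,5)]
    have "hook_length p i (x - t + m - k) = t" using h(2) m(3) x(2) i(2) by simp
    then show False using core h(1) by (auto simp: is_core_def)
  qed
next
  let ?f = "row_length p"
  have f: "shape k ?f" using p by (rule shape_row_length)
  assume flush: "flush t (beta k ?f)"
  show "is_core t p"
    unfolding is_core_def
  proof (intro conjI p(1) ballI, clarify)
    fix i j assume cell: "(i, j) \<in> cells p" and t: "t = hook_length p i j"
    define m where "m = (LEAST m. ?f m \<le> j)"
    have fk: "?f k \<le> j" using shapeD(2)[OF f] by simp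
    then have m: "?f m \<le> j" "m \<le> k" unfolding m_def by (auto intro: LeastI Least_le)
    have before: "j < ?f l" if "l < m" for l using that not_less_Least unfolding m_def by fastforce
    have im: "i < m" using cell m(1) shapeD(1)[OF f, of m i] by (force simp: cells_row_length)
    have h: "t + (j + k) = bead k ?f i + m"
      using hook_length_eq(2)[OF p im m(2) before m(1)] im t by simp
    have "bead k ?f i \<in> beta k ?f" using im m(2) by (auto simp: beta_def)
    moreover have "t \<le> bead k ?f i" using h m(2) by simp
    ultimately have "bead k ?f i - t \<in> beta k ?f" using flush by (simp add: flush_def)
    then obtain l where l: "l < k" "bead k ?f i - t = bead k ?f l" by (auto simp: beta_def)
    \<comment> \<open>This would make \<open>j + k - m\<close> the bead of row \<open>l\<close>.
      Rows above \<open>m\<close> are longer than \<open>j\<close> and have larger beads; rows from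
      \<open>m\<close> on have length at most \<open>j\<close> and have smaller ones.\<close>
    then have eq: "j + k = m + bead k ?f l" using h m(2) by simp
    show False
    proof (cases "l < m")
      case True
      then show False using before[OF True] eq l m(2) by (simp add: bead_def)
    next
      case False
      then have "?f l \<le> j" using m(1) shapeD(1)[OF f, of m l] by simp
      then show False using False eq l by (simp add: bead_def)
    qed
  qed
qed

text \<open>A rim hook occupying the rows \<open>a, \<dots>, c\<close>: removing it moves the row \<open>i + 1\<close>, shortened by one
  cell, up to the row \<open>i\<close>.\<close>

definition rim_hook :: "nat \<Rightarrow> (nat \<Rightarrow> nat) \<Rightarrow> (nat \<Rightarrow> nat) \<Rightarrow> nat \<Rightarrow> nat \<Rightarrow> bool" where
  "rim_hook k f g a c \<longleftrightarrow> a \<le> c \<and> c < k \<and> (\<forall>i. a \<le> i \<longrightarrow> i < c \<longrightarrow> Suc (g i) = f (Suc i)) \<and>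
    (\<forall>i. i < a \<or> c < i \<longrightarrow> g i = f i) \<and> g c < f c"

lemma rim_hook_le:
  assumes "shape k f" "rim_hook k f g a c" shows "g i \<le> f i"
proof (cases "a \<le> i \<and> i < c")
  case True
  then have "Suc (g i) = f (Suc i)" using assms(2) by (simp add: rim_hook_def)
  then show ?thesis using shapeD(1)[OF assms(1), of i "Suc i"] by simp
next
  case False
  then consider "i < a \<or> c < i" | "i = c" by linarith
  then show ?thesis using assms(2) by cases (auto simp: rim_hook_def)
qed

lemma rim_hook_less:
  assumes "shape k f" "rim_hook k f g a c" shows "g i < f i \<longleftrightarrow> a \<le> i \<and> i \<le> c"
proof
  assume "a \<le> i \<and> i \<le> c"
  then consider "a \<le> i" "i < c" | "i = c" by linarith
  then show "g i < f i"
  proof cases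
    case 1
    then have "Suc (g i) = f (Suc i)" using assms(2) by (simp add: rim_hook_def)
    then show ?thesis using shapeD(1)[OF assms(1), of i "Suc i"] by simp
  qed (use assms(2) in \<open>auto simp: rim_hook_def\<close>)
next
  assume "g i < f i"
  then show "a \<le> i \<and> i \<le> c" using assms(2) by (auto simp: rim_hook_def not_le[symmetric])
qed

lemma card_skew:
  assumes "shape k f" shows "finite {(i, j). g i \<le> j \<and> j < f i}"
    and "card {(i, j). g i \<le> j \<and> j < f i} = (\<Sum>i<k. f i - g i)"
proof -
  have "{(i, j). g i \<le> j \<and> j < f i} = Sigma {..<k} (\<lambda>i. {g i..<f i})"
    using shapeD(2)[OF assms] by (auto simp: not_le[symmetric])
  then show "finite {(i, j). g i \<le> j \<and> j < f i}"
    and "card {(i, j). g i \<le> j \<and> j < f i} = (\<Sum>i<k. f i - g i)" by auto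
qed

text \<open>Moving a row up by one index raises its bead by one, and losing a cell lowers it again.
  So the beads of rows a + 1 to c survive, and the only change is that the bead of row
  \<open>a\<close> is replaced by the new bead of row \<open>c\<close>.\<close>

lemma rim_hook_beta:
  assumes f: "shape k f" and g: "shape k g" and h: "rim_hook k f g a c"
  shows "bead k g c \<notin> beta k f - {bead k f a}" "bead k f a \<in> beta k f"
    and "beta k g = insert (bead k g c) (beta k f - {bead k f a})"
    and "bead k g c + card {(i, j). g i \<le> j \<and> j < f i} = bead k f a"
proof -
  have ac: "a \<le> c" "c < k" using h by (auto simp: rim_hook_def)
  have up: "bead k g i = bead k f (Suc i)" if "a \<le> i" "i < c" for i
  proof -
    have "Suc (g i) = f (Suc i)" using h that by (simp add: rim_hook_def)
    then show ?thesis using that ac by (simp add: bead_def)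
  qed
  have same: "bead k g i = bead k f i" if "i < a \<or> c < i" for i
    using h that by (auto simp: rim_hook_def bead_def)
  have rest: "bead k g ` ({..<k} - {c}) = beta k f - {bead k f a}"
  proof -
    have "{..<k} - {c} = {..<a} \<union> {a..<c} \<union> {c<..<k}" using ac by auto
    then have "bead k g ` ({..<k} - {c}) = bead k g ` {..<a} \<union> bead k g ` {a..<c} \<union> bead k g ` {c<..<k}"
      by (simp only: image_Un)
    also have "bead k g ` {..<a} = bead k f ` {..<a}" using same by (intro image_cong) auto
    also have "bead k g ` {c<..<k} = bead k f ` {c<..<k}" using same by (intro image_cong) auto
    also have "bead k g ` {a..<c} = (\<lambda>i. bead k f (Suc i)) ` {a..<c}" using up by (intro image_cong) auto
    also have "\<dots> = bead k f ` {a<..c}"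
      unfolding image_image[of "bead k f" Suc, symmetric] by (simp add: image_Suc_atLeastLessThan atLeastLessThanSuc_atLeastAtMost atLeastSucAtMost_greaterThanAtMost)
    also have "bead k f ` {..<a} \<union> bead k f ` {a<..c} \<union> bead k f ` {c<..<k} = bead k f ` ({..<k} - {a})"
      unfolding image_Un[symmetric] using ac by (intro arg_cong[where f = "\<lambda>X. bead k f ` X"]) auto
    also have "\<dots> = beta k f - {bead k f a}"
      unfolding beta_def using ac inj_on_image_set_diff[OF inj_bead[OF f], of "{..<k}" "{a}"] by simp
    finally show ?thesis .
  qed
  show new: "bead k g c \<notin> beta k f - {bead k f a}"
    unfolding rest[symmetric] using inj_bead[OF g] ac by (auto dest: inj_onD)
  show a: "bead k f a \<in> beta k f" using ac by (simp add: beta_def)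
  show "beta k g = insert (bead k g c) (beta k f - {bead k f a})"
    unfolding rest[symmetric] using ac by (auto simp: beta_def)
  \<comment> \<open>The sum of all beads drops by the number of removed cells; cancelling the common
    beads leaves the distance moved.\<close>
  have "(\<Sum>i<k. f i - g i) + (\<Sum>i<k. bead k g i) = (\<Sum>i<k. bead k f i)"
    using rim_hook_le[OF f h] by (simp add: bead_def flip: sum.distrib)
  moreover have "(\<Sum>i<k. bead k f i) = bead k f a + \<Sum>(beta k f - {bead k f a})"
  proof -
    have "(\<Sum>i<k. bead k f i) = \<Sum>(beta k f)"
      unfolding beta_def using sum.reindex[OF inj_bead[OF f], of "\<lambda>x. x"] by simp
    then show ?thesis using sum.remove[OF finite_beta a, of "\<lambda>x. x"] by simp
  qed
  moreover have "(\<Sum>i<k. bead k g i) = bead k g c + \<Sum>(beta k f - {bead k f a})"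
  proof -
    have "inj_on (bead k g) ({..<k} - {c})" using inj_bead[OF g] Diff_subset by (rule inj_on_subset)
    then have "(\<Sum>i\<in>{..<k} - {c}. bead k g i) = \<Sum>(beta k f - {bead k f a})"
      unfolding rest[symmetric] using sum.reindex[of "bead k g" "{..<k} - {c}" "\<lambda>x. x"] by simp
    then show ?thesis using sum.remove[of "{..<k}" c "bead k g"] ac by simp
  qed
  ultimately show "bead k g c + card {(i, j). g i \<le> j \<and> j < f i} = bead k f a"
    unfolding card_skew(2)[OF f] by simp
qed

lemma rtranclp_crossing:
  assumes "R\<^sup>*\<^sup>* x y" "P x" "\<not> P y" shows "\<exists>u v. R u v \<and> P u \<and> \<not> P v"
  using assms by (induction rule: rtranclp_induct) blast+

text \<open>Connectedness makes consecutive rows of the skew shape share at least one column, and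
  the absence of 2 by 2 squares at most one.\<close>

lemma skew_connected_imp_rim_hook:
  assumes f: "shape k f" and g: "shape k g" and le: "\<And>i. g i \<le> f i"
  defines "D \<equiv> {(i, j). g i \<le> j \<and> j < f i}"
  assumes ne: "D \<noteq> {}" and conn: "cells_connected D" and no: "no_2x2 D"
  shows "\<exists>a c. rim_hook k f g a c"
proof -
  define Rw where "Rw = {i. g i < f i}"
  have "Rw \<subseteq> {..<k}"
  proof
    fix i assume "i \<in> Rw"
    then have "f i \<noteq> 0" by (simp add: Rw_def)
    then show "i \<in> {..<k}" using shapeD(2)[OF f, of i] by (cases "i < k") auto
  qed
  then have fin: "finite Rw" by (rule finite_subset) simp
  have "Rw \<noteq> {}"
  proof -
    obtain i j where "(i, j) \<in> D" using ne by auto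
    then have "i \<in> Rw" by (simp add: D_def Rw_def)
    then show ?thesis by blast
  qed
  define a c where "a = Min Rw" and "c = Max Rw"
  have ac: "a \<in> Rw" "c \<in> Rw" using fin \<open>Rw \<noteq> {}\<close> by (auto simp: a_def c_def)
  have out: "g i = f i" if "i < a \<or> c < i" for i
  proof -
    have "i \<notin> Rw" using that fin unfolding a_def c_def by (meson Max_ge Min_le not_le)
    then show ?thesis using le[of i] by (simp add: Rw_def)
  qed
  have "Suc (g i) = f (Suc i)" if i: "a \<le> i" "i < c" for i
  proof (rule antisym)
    have "(a, g a) \<in> D" "(c, g c) \<in> D" using ac by (auto simp: D_def Rw_def)
    then have "(\<lambda>x y. x \<in> D \<and> y \<in> D \<and> cell_adj x y)\<^sup>*\<^sup>* (a, g a) (c, g c)"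
      using conn by (auto simp: cells_connected_def)
    \<comment> \<open>A path from row \<open>a\<close> to row \<open>c\<close> must step from row
      \<open>i\<close> or above to a lower row, and such a step is vertical, from row
      \<open>i\<close> to row \<open>Suc i\<close>.\<close>
    from rtranclp_crossing[OF this, of "\<lambda>x. fst x \<le> i"] i
    obtain u v where uv: "u \<in> D" "v \<in> D" "cell_adj u v" "fst u \<le> i" "\<not> fst v \<le> i" by auto
    then obtain j where "u = (i, j)" "v = (Suc i, j)"
      by (cases u, cases v) (auto simp: cell_adj_def)
    then show "Suc (g i) \<le> f (Suc i)" using uv by (auto simp: D_def)
    show "f (Suc i) \<le> Suc (g i)"
    proof (rule ccontr)
      assume "\<not> f (Suc i) \<le> Suc (g i)"
      then have "{(i, g i), (i + 1, g i), (i, g i + 1), (i + 1, g i + 1)} \<subseteq> D"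
        using shapeD(1)[OF g, of i "Suc i"] shapeD(1)[OF f, of i "Suc i"] by (auto simp: D_def)
      then show False using no unfolding no_2x2_def by blast
    qed
  qed
  moreover have "a \<le> c" using fin ac by (simp add: a_def)
  moreover have "c < k" "g c < f c" using ac \<open>Rw \<subseteq> {..<k}\<close> by (auto simp: Rw_def)
  ultimately show ?thesis using out unfolding rim_hook_def by blast
qed

text \<open>Every cell is joined to the cell \<open>(c, g c)\<close>: go left to the start of the
  row, then down. The cell below the start of row i is the last cell of row i + 1 because
  \<open>f (Suc i) = Suc (g i)\<close>, which also excludes 2 by 2 squares.\<close>

lemma rim_hook_imp_skew_connected:
  assumes f: "shape k f" and g: "shape k g" and h: "rim_hook k f g a c"
  defines "D \<equiv> {(i, j). g i \<le> j \<and> j < f i}"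
  shows "cells_connected D" "no_2x2 D" "D \<noteq> {}"
proof -
  let ?R = "\<lambda>x y. x \<in> D \<and> y \<in> D \<and> cell_adj x y"
  have up: "Suc (g i) = f (Suc i)" if "a \<le> i" "i < c" for i
    using h that by (simp add: rim_hook_def)
  have rows: "a \<le> i \<and> i \<le> c" if "(i, j) \<in> D" for i j
    using rim_hook_less[OF f h, of i] that by (simp add: D_def)
  have "(c, g c) \<in> D" using h by (simp add: D_def rim_hook_def)
  then show "D \<noteq> {}" by blast
  have left: "?R\<^sup>*\<^sup>* (i, j) (i, g i)" if "(i, j) \<in> D" for i j
    using that
  proof (induction "j - g i" arbitrary: j)
    case 0
    then have "j = g i" by (simp add: D_def)
    then show ?case by simp
  next
    case (Suc n)
    then have j: "j = Suc (j - 1)" "(i, j - 1) \<in> D" by (auto simp: D_def)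
    then have "?R (i, j) (i, j - 1)" using Suc.prems by (simp add: cell_adj_def)
    moreover have "?R\<^sup>*\<^sup>* (i, j - 1) (i, g i)" using Suc.hyps(2) j(2) by (intro Suc.hyps(1)) auto
    ultimately show ?case by (rule converse_rtranclp_into_rtranclp)
  qed
  have down: "?R\<^sup>*\<^sup>* (i, g i) (c, g c)" if "a \<le> i" "i \<le> c" for i
    using that(2,1)
  proof (induction i rule: inc_induct)
    case (step i)
    have "g i < f i" using rim_hook_less[OF f h, of i] step by simp
    moreover have "(Suc i, g i) \<in> D"
      using up[of i] shapeD(1)[OF g, of i "Suc i"] step by (simp add: D_def)
    ultimately have "?R (i, g i) (Suc i, g i)" by (simp add: D_def cell_adj_def)
    also have "?R\<^sup>*\<^sup>* (Suc i, g i) (Suc i, g (Suc i))" by (rule left) fact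
    also have "?R\<^sup>*\<^sup>* (Suc i, g (Suc i)) (c, g c)" using step by simp
    finally show ?case .
  qed simp
  have to_c: "?R\<^sup>*\<^sup>* x (c, g c)" if "x \<in> D" for x
  proof -
    obtain i j where x: "x = (i, j)" by (cases x)
    have "?R\<^sup>*\<^sup>* (i, j) (i, g i)" using left that x by blast
    also have "?R\<^sup>*\<^sup>* (i, g i) (c, g c)" using down rows that x by blast
    finally show ?thesis using x by simp
  qed
  have "symp ?R" by (auto simp: symp_def cell_adj_def)
  then have "symp ?R\<^sup>*\<^sup>*" by (rule symp_rtranclp)
  then have "?R\<^sup>*\<^sup>* x y" if "x \<in> D" "y \<in> D" for x y
    using to_c[OF that(1)] to_c[OF that(2)] by (meson rtranclp_trans sympD)
  then show "cells_connected D" by (simp add: cells_connected_def)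
  show "no_2x2 D"
    unfolding no_2x2_def
  proof clarify
    fix i j assume "{(i, j), (i + 1, j), (i, j + 1), (i + 1, j + 1)} \<subseteq> D"
    then have D: "(i, j) \<in> D" "(Suc i, Suc j) \<in> D" by auto
    then have "Suc (g i) = f (Suc i)" using rows by (intro up) fastforce+
    then show False using D by (simp add: D_def)
  qed
qed

lemma cells_diff:
  "cells p - cells q = {(i, j). row_length q i \<le> j \<and> j < row_length p i}"
  by (auto simp: cells_row_length)

lemma cells_subset_iff: "cells q \<subseteq> cells p \<longleftrightarrow> (\<forall>i. row_length q i \<le> row_length p i)"
proof -
  have "row_length q i \<le> row_length p i" if "cells q \<subseteq> cells p" for i
  proof (rule ccontr)
    assume "\<not> row_length q i \<le> row_length p i"
    then have "(i, row_length p i) \<in> cells q - cells p" by (simp add: cells_row_length)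
    then show False using that by blast
  qed
  then show ?thesis by (auto simp: cells_row_length intro: less_le_trans)
qed

lemma cells_subset_length:
  assumes "is_partition p" "is_partition q" "cells q \<subseteq> cells p" shows "length q \<le> length p"
proof (rule ccontr)
  assume "\<not> length q \<le> length p"
  then have "0 < row_length q (length p)" using assms(2) row_length_pos_iff by simp
  then show False using assms(3) by (metis cells_subset_iff row_length_def less_irrefl not_le)
qed

lemma rim_hook_removal_beta:
  assumes r: "rim_hook_removal t p q" and k: "length p \<le> k"
  shows "\<exists>x\<in>beta k (row_length p). t \<le> x \<and> x - t \<notin> beta k (row_length p) - {x} \<and>
     beta k (row_length q) = insert (x - t) (beta k (row_length p) - {x})"
proof -
  let ?f = "row_length p" and ?g = "row_length q"
  have p: "is_partition p" "is_partition q" "cells q \<subseteq> cells p"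
    using r by (auto simp: rim_hook_removal_def)
  have f: "shape k ?f" and g: "shape k ?g"
    using p k cells_subset_length[OF p] by (auto intro: shape_row_length)
  have skew: "{(i, j). ?g i \<le> j \<and> j < ?f i} \<noteq> {}" "cells_connected {(i, j). ?g i \<le> j \<and> j < ?f i}"
      "no_2x2 {(i, j). ?g i \<le> j \<and> j < ?f i}"
    using r unfolding rim_hook_removal_def cells_diff by simp_all
  have "?g i \<le> ?f i" for i using p(3) by (simp add: cells_subset_iff)
  from skew_connected_imp_rim_hook[OF f g this skew] obtain a c where h: "rim_hook k ?f ?g a c"
    by blast
  have "card {(i, j). ?g i \<le> j \<and> j < ?f i} = t"
    using r by (simp add: rim_hook_removal_def cells_diff)
  then have t: "t \<le> bead k ?f a" and eq: "bead k ?f a - t = bead k ?g c"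
    using rim_hook_beta(4)[OF f g h] by auto
  show ?thesis
    by (intro bexI[of _ "bead k ?f a"] conjI; (unfold eq)?) (rule t rim_hook_beta[OF f g h])+
qed

lemma bead_move_rim_hook:
  assumes f: "shape k f" and x: "x \<in> beta k f" "t \<le> x" "x - t \<notin> beta k f" and "0 < t"
  shows "\<exists>g a c. shape k g \<and> rim_hook k f g a c \<and> card {(i, j). g i \<le> j \<and> j < f i} = t"
proof -
  obtain a where a: "a < k" "x = bead k f a" using x(1) by (auto simp: beta_def)
  obtain m where m: "a < m" "m \<le> k" "k \<le> x - t + m" "x - t + m - k < f (m - 1)" "f m \<le> x - t + m - k"
    using gap_position[OF f a(1) _ x(3)] x(2) a(2) \<open>0 < t\<close> by (metis diff_less less_le_trans)
  \<comment> \<open>Row \<open>c\<close> is the last one whose bead lies above the gap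
    \<open>x - t\<close>, and \<open>z\<close> is the length that moves its bead to the gap.\<close>
  define c where "c = m - 1"
  define z where "z = x - t + m - k"
  have c: "a \<le> c" "c < k" "m = Suc c" using m(1,2) by (auto simp: c_def)
  have z: "z < f c" "f (Suc c) \<le> z" using m(4,5) c(3) by (auto simp: z_def)
  define g where "g i = (if a \<le> i \<and> i < c then f (Suc i) - 1 else if i = c then z else f i)" for i
  have dec: "f (Suc i) \<le> f i" for i using shapeD(1)[OF f] by simp
  \<comment> \<open>Makes the truncated subtraction in \<open>g\<close> exact and keeps the shifted
    rows at least as long as \<open>z\<close>.\<close>
  have pos: "f (Suc i) \<ge> Suc z" if "i < c" for i
    using shapeD(1)[OF f, of "Suc i" c] that z by simp
  have "g (Suc i) \<le> g i" for i
  proof -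
    consider "Suc i < a" | "Suc i = a" "a < c" | "Suc i = a" "a = c" | "a \<le> i" "Suc i < c"
      | "a \<le> i" "Suc i = c" | "i = c" | "c < i" using c(1) by linarith
    then show ?thesis
    proof cases
      case 5
      then show ?thesis using pos[of i] z by (auto simp: g_def)
    next
      case 3
      then show ?thesis using dec[of i] z c by (auto simp: g_def)
    next
      case 2
      then show ?thesis using dec[of i] dec[of a] by (auto simp: g_def)
    next
      case 4
      then show ?thesis using dec[of "Suc i"] by (auto simp: g_def)
    qed (use dec[of i] z c in \<open>auto simp: g_def\<close>)
  qed
  then have "antimono g" by (simp add: antimono_iff_le_Suc)
  moreover have "g i = 0" if "k \<le> i" for i using shapeD(2)[OF f that] c that by (simp add: g_def)
  ultimately have g: "shape k g" by (simp add: shape_def)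
  have h: "rim_hook k f g a c"
    unfolding rim_hook_def
  proof (intro conjI allI impI)
    fix i assume "a \<le> i" "i < c"
    then show "Suc (g i) = f (Suc i)" using pos[of i] by (simp add: g_def)
  qed (use c z in \<open>auto simp: g_def\<close>)
  have "bead k g c = x - t"
    using c m(3) by (simp add: bead_def g_def z_def)
  then have "card {(i, j). g i \<le> j \<and> j < f i} = t"
    using rim_hook_beta(4)[OF f g h] a(2) x(2) by simp
  then show ?thesis using g h by blast
qed

lemma not_core_removal:
  assumes p: "is_partition p" and "0 < t" and "\<not> is_core t p"
  shows "\<exists>q. rim_hook_removal t p q"
proof -
  let ?f = "row_length p" and ?k = "length p"
  have f: "shape ?k ?f" using p by (rule shape_row_length) simp
  obtain x where x: "x \<in> beta ?k ?f" "t \<le> x" "x - t \<notin> beta ?k ?f"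
    using is_core_iff_flush[OF p order_refl \<open>0 < t\<close>] assms(3) by (auto simp: flush_def)
  obtain g a c where g: "shape ?k g" and h: "rim_hook ?k ?f g a c"
    and card: "card {(i, j). g i \<le> j \<and> j < ?f i} = t"
    using bead_move_rim_hook[OF f x \<open>0 < t\<close>] by blast
  obtain q where q: "is_partition q" "row_length q = g"
    using partition_of_shape[OF g] by blast
  have "cells q \<subseteq> cells p"
    using rim_hook_le[OF f h] by (simp add: cells_subset_iff q(2))
  then have "rim_hook_removal t p q"
    using rim_hook_imp_skew_connected[OF f g h] card p q(1)
    unfolding rim_hook_removal_def cells_diff q(2) by blast
  then show ?thesis by blast
qed

section \<open>Cores and the numbers of beads on the runners\<close>

definition runner_count :: "nat \<Rightarrow> nat set \<Rightarrow> nat \<Rightarrow> nat" where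
  "runner_count t B r = card {x \<in> B. x mod t = r}"

lemma removal_runner_count:
  assumes r: "rim_hook_removal t p q" and k: "length p \<le> k"
  shows "runner_count t (beta k (row_length q)) i = runner_count t (beta k (row_length p)) i"
proof -
  let ?B = "beta k (row_length p)"
  obtain x where x: "x \<in> ?B" "t \<le> x" "x - t \<notin> ?B - {x}"
    and q: "beta k (row_length q) = insert (x - t) (?B - {x})"
    using rim_hook_removal_beta[OF r k] by blast
  have m: "(x - t) mod t = x mod t" using x(2) by (simp add: le_mod_geq)
  show ?thesis
  proof (cases "x mod t = i")
    case True
    have "{y \<in> beta k (row_length q). y mod t = i} = insert (x - t) ({y \<in> ?B. y mod t = i} - {x})"
      unfolding q using True m by auto
    moreover have "card (insert (x - t) ({y \<in> ?B. y mod t = i} - {x})) = Suc (card ({y \<in> ?B. y mod t = i} - {x}))"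
      using x(3) by (intro card_insert_disjoint) auto
    moreover have "Suc (card ({y \<in> ?B. y mod t = i} - {x})) = card {y \<in> ?B. y mod t = i}"
      using x(1) True by (intro card_Suc_Diff1) auto
    ultimately show ?thesis unfolding runner_count_def by simp
  next
    case False
    then have "{y \<in> beta k (row_length q). y mod t = i} = {y \<in> ?B. y mod t = i}"
      unfolding q using m by auto
    then show ?thesis by (simp add: runner_count_def)
  qed
qed

lemma removals_invariant:
  assumes "(rim_hook_removal t)\<^sup>*\<^sup>* p q" "is_partition p" "length p \<le> k"
  shows "is_partition q \<and> length q \<le> k \<and>
    runner_count t (beta k (row_length q)) = runner_count t (beta k (row_length p))"
  using assms(1)
proof (induction rule: rtranclp_induct)
  case (step q r)
  have "is_partition r" "length r \<le> length q"
    using step.hyps(2) cells_subset_length by (auto simp: rim_hook_removal_def)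
  then show ?case
    using step.IH removal_runner_count[OF step.hyps(2), of k] by auto
qed (use assms in auto)

lemma finite_cells: "finite (cells p)"
proof -
  have "cells p \<subseteq> (SIGMA i:{..<length p}. {..<p ! i})" by (auto simp: cells_def)
  then show ?thesis by (rule finite_subset) auto
qed

lemma core_exists:
  assumes "is_partition p" "0 < t"
  shows "\<exists>q. (rim_hook_removal t)\<^sup>*\<^sup>* p q \<and> is_core t q"
  using assms(1)
proof (induction "card (cells p)" arbitrary: p rule: less_induct)
  case less
  show ?case
  proof (cases "is_core t p")
    case False
    then obtain q where q: "rim_hook_removal t p q" using not_core_removal less.prems assms(2) by blast
    then have "cells q \<subset> cells p" "is_partition q" by (auto simp: rim_hook_removal_def)
    then obtain r where "(rim_hook_removal t)\<^sup>*\<^sup>* q r" "is_core t r"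
      using less.hyps[OF psubset_card_mono[OF finite_cells]] by blast
    then show ?thesis using q by (meson converse_rtranclp_into_rtranclp)
  qed auto
qed

lemma down_closed_nat:
  fixes L :: "nat set"
  assumes "finite L" "\<And>l. Suc l \<in> L \<Longrightarrow> l \<in> L" shows "L = {..<card L}"
proof -
  define n where "n = (LEAST n. n \<notin> L)"
  have "\<exists>n. n \<notin> L" using assms(1) infinite_UNIV_nat by (metis UNIV_eq_I)
  then have n: "n \<notin> L" unfolding n_def by (metis LeastI)
  have "l \<notin> L" if "n \<le> l" for l
    using that by (induction l rule: dec_induct) (use n assms(2) in auto)
  moreover have "l \<in> L" if "l < n" for l using that not_less_Least unfolding n_def by blast
  ultimately have "L = {..<n}" by (auto simp: not_le[symmetric])
  then show ?thesis by simp
qed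

text \<open>The occupied positions of each runner are finite in number and closed under stepping
  down, so they form an initial segment, whose length is the runner count.\<close>

lemma flush_mem_iff:
  assumes "finite B" "flush t B" "0 < t"
  shows "x \<in> B \<longleftrightarrow> x div t < runner_count t B (x mod t)"
proof -
  define r where "r = x mod t"
  define L where "L = {l. r + l * t \<in> B}"
  have r: "r < t" using assms(3) by (simp add: r_def)
  have inj: "inj (\<lambda>l. r + l * t)" using assms(3) by (auto simp: inj_def)
  have img: "(\<lambda>l. r + l * t) ` L = {y \<in> B. y mod t = r}"
  proof (intro equalityI subsetI)
    fix y assume "y \<in> {y \<in> B. y mod t = r}"
    then have "y \<in> B" "y = r + y div t * t" by (auto simp: mod_div_mult_eq)
    then show "y \<in> (\<lambda>l. r + l * t) ` L" unfolding L_def by (metis (mono_tags) imageI mem_Collect_eq)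
  qed (use r in \<open>auto simp: L_def\<close>)
  have "finite ((\<lambda>l. r + l * t) ` L)" unfolding img using assms(1) by simp
  then have fin: "finite L" using inj by (auto dest: finite_imageD intro: inj_on_subset)
  have "l \<in> L" if "Suc l \<in> L" for l
  proof -
    have "r + Suc l * t - t \<in> B" using that assms(2) unfolding L_def flush_def by force
    then show ?thesis by (simp add: L_def algebra_simps)
  qed
  from down_closed_nat[OF fin this] have L: "L = {..<card L}" by blast
  have "card L = runner_count t B r"
    unfolding runner_count_def img[symmetric] using inj by (simp add: card_image inj_on_subset)
  moreover have "x \<in> B \<longleftrightarrow> x div t \<in> L" by (simp add: L_def r_def mod_div_mult_eq)
  ultimately show ?thesis using L by (metis lessThan_iff r_def)
qed

lemma flush_eqI:
  assumes "finite B" "flush t B" "finite B'" "flush t B'" "0 < t"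
    and "\<And>r. r < t \<Longrightarrow> runner_count t B r = runner_count t B' r"
  shows "B = B'"
proof -
  have "x \<in> B \<longleftrightarrow> x \<in> B'" for x
    using flush_mem_iff[OF assms(1,2,5)] flush_mem_iff[OF assms(3,4,5)] assms(5,6) by simp
  then show ?thesis by blast
qed

lemma core_eqI:
  assumes "is_core t p" "is_core t q" "length p \<le> k" "length q \<le> k" "0 < t"
    and "\<And>r. r < t \<Longrightarrow> runner_count t (beta k (row_length p)) r = runner_count t (beta k (row_length q)) r"
  shows "p = q"
proof -
  have pq: "is_partition p" "is_partition q" using assms(1,2) by (auto simp: is_core_def)
  have "beta k (row_length p) = beta k (row_length q)"
    using assms is_core_iff_flush pq by (intro flush_eqI[where t = t]) auto
  then have "row_length p = row_length q"
    using beta_inject shape_row_length pq assms(3,4) by blast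
  then show ?thesis using partition_eqI pq by blast
qed

text \<open>Removals preserve the runner counts, and these determine a core. Hence all removal
  sequences that end in a core end in the same one, and the definite description in
  \<open>core\<close> is well defined.\<close>

lemma core_eq_iff:
  assumes p: "is_partition p" "length p \<le> k" and \<sigma>: "is_core t \<sigma>" "length \<sigma> \<le> k" and t: "0 < t"
  shows "core t p = \<sigma> \<longleftrightarrow>
    (\<forall>r<t. runner_count t (beta k (row_length p)) r = runner_count t (beta k (row_length \<sigma>)) r)"
proof -
  obtain q where q: "(rim_hook_removal t)\<^sup>*\<^sup>* p q" "is_core t q" using core_exists[OF p(1) t] by blast
  note inv = removals_invariant[OF _ p]
  have "core t p = q"
    unfolding core_def
  proof (rule the_equality)
    fix q' assume q': "(rim_hook_removal t)\<^sup>*\<^sup>* p q' \<and> is_core t q'"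
    then show "q' = q"
      using inv[OF q(1)] inv[where q = q'] q(2) t by (intro core_eqI[where t = t and k = k]) auto
  qed (use q in blast)
  moreover have "q = \<sigma> \<longleftrightarrow> (\<forall>r<t. runner_count t (beta k (row_length q)) r = runner_count t (beta k (row_length \<sigma>)) r)"
    using core_eqI[OF q(2) \<sigma>(1) _ \<sigma>(2) t] inv[OF q(1)] by blast
  ultimately show ?thesis using inv[OF q(1)] by simp
qed

text \<open>Padding with \<open>n * t\<close> empty rows shifts all beads by \<open>n * t\<close>
  and fills the positions below \<open>n * t\<close>, which contain \<open>n\<close> elements of
  each residue class.\<close>

lemma runner_count_beta_shift:
  assumes f: "shape k f" and r: "r < t"
  shows "runner_count t (beta (k + n * t) f) r = runner_count t (beta k f) r + n"
proof -
  let ?m = "n * t"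
  have "bead (k + ?m) f i = bead k f i + ?m" if "i < k" for i using that by (simp add: bead_def)
  then have 1: "bead (k + ?m) f ` {..<k} = (\<lambda>x. x + ?m) ` beta k f"
    unfolding beta_def image_image by (intro image_cong) auto
  have 2: "bead (k + ?m) f ` {k..<k + ?m} = {..<?m}"
  proof (intro equalityI subsetI)
    fix x assume "x \<in> {..<?m}"
    then show "x \<in> bead (k + ?m) f ` {k..<k + ?m}"
      using shapeD(2)[OF f, of "k + ?m - 1 - x"] by (intro image_eqI[of _ _ "k + ?m - 1 - x"]) (auto simp: bead_def)
  next
    fix x assume "x \<in> bead (k + ?m) f ` {k..<k + ?m}"
    then show "x \<in> {..<?m}" using shapeD(2)[OF f] by (auto simp: bead_def)
  qed
  have "{..<k + ?m} = {..<k} \<union> {k..<k + ?m}" by auto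
  then have "beta (k + ?m) f = (\<lambda>x. x + ?m) ` beta k f \<union> {..<?m}"
    unfolding beta_def[of "k + ?m"] by (simp only: image_Un 1 2)
  then have "{x \<in> beta (k + ?m) f. x mod t = r} =
      (\<lambda>x. x + ?m) ` {x \<in> beta k f. x mod t = r} \<union> {x \<in> {..<?m}. x mod t = r}" by auto
  moreover have "card ((\<lambda>x. x + ?m) ` {x \<in> beta k f. x mod t = r}) = runner_count t (beta k f) r"
    unfolding runner_count_def by (intro card_image) (auto intro: inj_onI)
  moreover have "card {x \<in> {..<?m}. x mod t = r} = n"
  proof -
    have "{x \<in> {..<?m}. x mod t = r} = (\<lambda>l. r + l * t) ` {..<n}"
    proof (intro equalityI subsetI)
      fix x assume "x \<in> {x \<in> {..<?m}. x mod t = r}"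
      then have "x = r + x div t * t" "x div t < n" by (auto simp: mod_div_mult_eq less_mult_imp_div_less)
      then show "x \<in> (\<lambda>l. r + l * t) ` {..<n}" by blast
    next
      fix x assume "x \<in> (\<lambda>l. r + l * t) ` {..<n}"
      then obtain l where l: "l < n" "x = r + l * t" by auto
      then have "x < Suc l * t" using r by simp
      also have "\<dots> \<le> ?m" using l(1) by (intro mult_right_mono) auto
      finally show "x \<in> {x \<in> {..<?m}. x mod t = r}" using l r by simp
    qed
    moreover have "inj_on (\<lambda>l. r + l * t) {..<n}" using r by (intro inj_onI) auto
    ultimately show ?thesis by (simp add: card_image)
  qed
  moreover have "(\<lambda>x. x + ?m) ` {x \<in> beta k f. x mod t = r} \<inter> {x \<in> {..<?m}. x mod t = r} = {}" by auto
  ultimately show ?thesis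
    unfolding runner_count_def[of t "beta (k + ?m) f"] by (simp add: card_Un_disjoint)
qed

lemma sum_card_residues:
  fixes A :: "nat set"
  assumes "finite A" "0 < s" shows "(\<Sum>j<s. card {x \<in> A. x mod s = j}) = card A"
proof -
  have "(\<Sum>j<s. \<Sum>x\<in>{x \<in> A. x mod s = j}. 1) = (\<Sum>x\<in>A. 1::nat)"
    using assms by (intro sum.group) auto
  then show ?thesis by simp
qed

lemma sum_runner_count:
  "finite B \<Longrightarrow> 0 < t \<Longrightarrow> (\<Sum>r<t. runner_count t B r) = card B"
  unfolding runner_count_def by (rule sum_card_residues)

section \<open>Residue tables and the count of st-cores\<close>

definition residue_table :: "nat \<Rightarrow> nat \<Rightarrow> nat set \<Rightarrow> nat \<times> nat \<Rightarrow> nat" where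
  "residue_table s t B = (\<lambda>(i, j). card {x \<in> B. x mod t = i \<and> x mod s = j})"

lemma residue_table_margins:
  assumes "finite B" "0 < s" "0 < t"
  shows "(\<Sum>j<s. residue_table s t B (i, j)) = runner_count t B i"
    and "(\<Sum>i<t. residue_table s t B (i, j)) = runner_count s B j"
proof -
  have "(\<Sum>j<s. card {x \<in> {x \<in> B. x mod t = i}. x mod s = j}) = card {x \<in> B. x mod t = i}"
    using assms by (intro sum_card_residues) auto
  then show "(\<Sum>j<s. residue_table s t B (i, j)) = runner_count t B i"
    by (simp add: residue_table_def runner_count_def conj_ac)
  have "(\<Sum>i<t. card {x \<in> {x \<in> B. x mod s = j}. x mod t = i}) = card {x \<in> B. x mod s = j}"
    using assms by (intro sum_card_residues) auto
  then show "(\<Sum>i<t. residue_table s t B (i, j)) = runner_count s B j"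
    by (simp add: residue_table_def runner_count_def conj_ac)
qed

lemma residues_determine:
  fixes s t x y :: nat
  assumes "coprime s t"
  shows "x mod (s * t) = y mod (s * t) \<longleftrightarrow> x mod t = y mod t \<and> x mod s = y mod s"
  using assms unfolding cong_def[symmetric]
  by (metis cong_modulus_mult_nat coprime_cong_mult_nat mult.commute)

text \<open>By the Chinese remainder theorem each runner modulo st is one cell of the table.\<close>

lemma runner_count_residue_table:
  assumes "coprime s t" "r < s * t"
  shows "runner_count (s * t) B r = residue_table s t B (r mod t, r mod s)"
  using residues_determine[OF assms(1), of _ r] assms(2)
  by (simp add: runner_count_def residue_table_def)

lemma residue_table_realizable:
  fixes N :: "nat \<times> nat \<Rightarrow> nat"
  assumes st: "0 < s" "0 < t" "coprime s t"
  shows "\<exists>B. finite B \<and> flush (s * t) B \<and>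
    (\<forall>i<t. \<forall>j<s. residue_table s t B (i, j) = N (i, j))"
proof -
  let ?p = "s * t"
  \<comment> \<open>On each runner modulo st, occupy as many initial positions as \<open>N\<close>
    prescribes for its cell.\<close>
  define B where "B = {x. x div ?p < N (x mod t, x mod s)}"
  have p: "0 < ?p" using st by simp
  define b where "b = (\<Sum>i<t. \<Sum>j<s. N (i, j))"
  have "x < b * ?p + ?p" if "x \<in> B" for x
  proof -
    have "N (x mod t, x mod s) \<le> (\<Sum>j<s. N (x mod t, j))"
      using st by (intro member_le_sum[where f = "\<lambda>j. N (x mod t, j)"]) auto
    also have "\<dots> \<le> b"
      unfolding b_def using st by (intro member_le_sum[where f = "\<lambda>i. \<Sum>j<s. N (i, j)"]) auto
    finally have "x div ?p < b" using that by (simp add: B_def)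
    then have "x < b * ?p" using p by (simp add: div_less_iff_less_mult)
    then show ?thesis by simp
  qed
  then have "finite B" by (meson finite_nat_set_iff_bounded)
  moreover have "flush ?p B"
    unfolding flush_def
  proof (intro ballI impI)
    fix x assume x: "x \<in> B" "?p \<le> x"
    have "(x - ?p) mod ?p = x mod ?p" using x(2) by (simp add: le_mod_geq)
    then have "(x - ?p) mod t = x mod t \<and> (x - ?p) mod s = x mod s"
      using residues_determine[OF st(3)] by blast
    moreover have "(x - ?p) div ?p \<le> x div ?p" by (intro div_le_mono) simp
    ultimately show "x - ?p \<in> B" using x(1) by (simp add: B_def)
  qed
  moreover have "residue_table s t B (i, j) = N (i, j)" if ij: "i < t" "j < s" for i j
  proof -
    obtain u where "[u = i] (mod t)" "[u = j] (mod s)"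
      using binary_chinese_remainder_nat[of t s i j] st(3) by (auto simp: coprime_commute)
    then have u: "u mod t = i" "u mod s = j" using ij by (auto simp: cong_def)
    define r where "r = u mod ?p"
    have r: "r < ?p" "r mod t = i" "r mod s = j"
      using u p residues_determine[OF st(3), of r u] by (auto simp: r_def)
    have eq: "x mod t = i \<and> x mod s = j \<longleftrightarrow> x mod ?p = r" for x
      using residues_determine[OF st(3), of x r] r by simp
    have "{x \<in> B. x mod t = i \<and> x mod s = j} = {x. x div ?p < N (i, j) \<and> x mod t = i \<and> x mod s = j}"
      by (auto simp: B_def)
    also have "\<dots> = {x. x div ?p < N (i, j) \<and> x mod ?p = r}" unfolding eq ..
    also have "\<dots> = (\<lambda>l. l * ?p + r) ` {..<N (i, j)}"
    proof (intro equalityI subsetI)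
      fix x assume "x \<in> {x. x div ?p < N (i, j) \<and> x mod ?p = r}"
      then show "x \<in> (\<lambda>l. l * ?p + r) ` {..<N (i, j)}"
        by (intro image_eqI[of _ _ "x div ?p"]) (auto simp: div_mult_mod_eq)
    next
      fix x assume "x \<in> (\<lambda>l. l * ?p + r) ` {..<N (i, j)}"
      then obtain l where "l < N (i, j)" "x = l * ?p + r" by blast
      moreover have "(l * ?p + r) div ?p = l"
        using r(1) by (intro div_nat_eqI) (simp_all add: algebra_simps)
      moreover have "(l * ?p + r) mod ?p = r"
        using r(1) by simp
      ultimately show "x \<in> {x. x div ?p < N (i, j) \<and> x mod ?p = r}" by simp
    qed
    also have "card \<dots> = N (i, j)"
      using p by (subst card_image) (auto intro: inj_onI)
    finally show ?thesis by (simp add: residue_table_def)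
  qed
  ultimately show ?thesis by blast
qed

text \<open>The residue table determines an st-core since its entries are the runner counts modulo
  st. The two core conditions fix its row and column sums, and every table with these margins comes
  from a flush set.\<close>

lemma N_count_eq_card_tables:
  assumes st: "0 < s" "0 < t" "coprime s t"
    and \<sigma>: "is_core s \<sigma>" "length \<sigma> \<le> k" and \<tau>: "is_core t \<tau>" "length \<tau> \<le> k"
  shows "N_count s t \<sigma> \<tau> k = card (tables t s ({..<t} \<times> {..<s})
    (\<lambda>i. int (runner_count t (beta k (row_length \<tau>)) i)) (\<lambda>j. int (runner_count s (beta k (row_length \<sigma>)) j)))"
proof -
  let ?E = "{..<t} \<times> {..<s}"
  let ?a = "runner_count t (beta k (row_length \<tau>))" and ?b = "runner_count s (beta k (row_length \<sigma>))"
  let ?S = "{p. is_core (s * t) p \<and> core s p = \<sigma> \<and> core t p = \<tau> \<and> length p \<le> k}"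
  let ?B = "\<lambda>p. beta k (row_length p)"
  define F where "F p = (\<lambda>e. if e \<in> ?E then residue_table s t (?B p) e else 0)" for p
  have core: "core s p = \<sigma> \<and> core t p = \<tau> \<longleftrightarrow>
      (\<forall>r<s. runner_count s (?B p) r = ?b r) \<and> (\<forall>r<t. runner_count t (?B p) r = ?a r)"
    if "is_partition p" "length p \<le> k" for p
    using core_eq_iff[OF that \<sigma> st(1)] core_eq_iff[OF that \<tau> st(2)] by simp
  have margins: "(\<Sum>j<s. int (F p (i, j))) = int (runner_count t (?B p) i)" if "i < t" for p i
    using that residue_table_margins(1)[OF finite_beta st(1,2)] by (simp add: F_def flip: of_nat_sum)
  have margins': "(\<Sum>i<t. int (F p (i, j))) = int (runner_count s (?B p) j)" if "j < s" for p j
    using that residue_table_margins(2)[OF finite_beta st(1,2)] by (simp add: F_def flip: of_nat_sum)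
  have "bij_betw F ?S (tables t s ?E (\<lambda>i. int (?a i)) (\<lambda>j. int (?b j)))"
  proof (rule bij_betw_imageI)
    show "inj_on F ?S"
    proof (rule inj_onI)
      fix p q assume pq: "p \<in> ?S" "q \<in> ?S" and eq: "F p = F q"
      have "residue_table s t (?B p) (i, j) = residue_table s t (?B q) (i, j)" if "i < t" "j < s" for i j
        using fun_cong[OF eq, of "(i, j)"] that by (simp add: F_def)
      then show "p = q"
        using pq st by (intro core_eqI[where t = "s * t" and k = k]) (auto simp: runner_count_residue_table)
    qed
    show "F ` ?S = tables t s ?E (\<lambda>i. int (?a i)) (\<lambda>j. int (?b j))"
    proof (intro equalityI subsetI)
      fix N assume "N \<in> F ` ?S"
      then obtain p where p: "p \<in> ?S" "N = F p" by blast
      then have "is_partition p" by (simp add: is_core_def)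
      then show "N \<in> tables t s ?E (\<lambda>i. int (?a i)) (\<lambda>j. int (?b j))"
        using p core[of p] unfolding tables_def by (simp add: margins margins') (auto simp: F_def)
    next
      fix N assume N: "N \<in> tables t s ?E (\<lambda>i. int (?a i)) (\<lambda>j. int (?b j))"
      obtain B where B: "finite B" "flush (s * t) B"
        "\<And>i j. i < t \<Longrightarrow> j < s \<Longrightarrow> residue_table s t B (i, j) = N (i, j)"
        using residue_table_realizable[OF st, of N] by blast
      have a: "runner_count t B i = ?a i" if "i < t" for i
      proof -
        have "int (\<Sum>j<s. N (i, j)) = int (?a i)" using N that by (simp add: tables_def)
        then show ?thesis
          using residue_table_margins(1)[OF B(1) st(1,2), of i] B(3) that by (simp del: of_nat_sum)
      qed
      have b: "runner_count s B j = ?b j" if "j < s" for j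
      proof -
        have "int (\<Sum>i<t. N (i, j)) = int (?b j)" using N that by (simp add: tables_def)
        then show ?thesis
          using residue_table_margins(2)[OF B(1) st(1,2), of j] B(3) that by (simp del: of_nat_sum)
      qed
      have "is_partition \<tau>" using \<tau>(1) by (simp add: is_core_def)
      \<comment> \<open>The row margins add up to the number of beads of \<open>\<tau>\<close>, so
        \<open>B\<close> has the right size to be the beta set of a partition with at most
        \<open>k\<close> parts.\<close>
      then have "card B = k"
        using sum_runner_count[OF B(1) st(2)] sum_runner_count[OF finite_beta st(2)] a
          card_beta[OF shape_row_length[OF _ \<tau>(2)]] by simp
      then obtain f where f: "shape k f" "beta k f = B" using shape_of_beta[OF B(1)] by blast
      obtain p where p: "is_partition p" "length p \<le> k" "row_length p = f"
        using partition_of_shape[OF f(1)] by blast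
      have "is_core (s * t) p"
        using is_core_iff_flush[OF p(1,2)] B(2) f(2) p(3) st by simp
      then have "p \<in> ?S" using core[OF p(1,2)] p(2,3) f(2) a b by simp
      moreover have "F p = N"
      proof -
        have "F p = (\<lambda>e. if e \<in> ?E then residue_table s t B e else 0)"
          unfolding F_def p(3) f(2) ..
        also have "\<dots> = N" using B(3) N by (auto simp: tables_def)
        finally show ?thesis .
      qed
      ultimately show "N \<in> F ` ?S" by blast
    qed
  qed
  then show ?thesis unfolding N_count_def by (rule bij_betw_same_card)
qed

theorem theorem1:
  fixes s t :: nat and \<sigma> \<tau> :: "nat list"
  assumes "0 < s" and "0 < t" and "coprime s t"
    and "is_core s \<sigma>" and "is_core t \<tau>"
  shows "\<exists>P :: nat \<Rightarrow> real poly.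
     (\<forall>i<s * t. degree (P i) = (s - 1) * (t - 1) \<and>
                lead_coeff (P i) = rel_volume (transport_polytope s t)) \<and>
     0 < rel_volume (transport_polytope s t) \<and>
     (\<exists>K. \<forall>k\<ge>K. real (N_count s t \<sigma> \<tau> k) = poly (P (k mod (s * t))) (real (k div (s * t))))"
proof -
  note st = assms(1-3)
  let ?V = "rel_volume (transport_polytope s t)"
  define L where "L = max (length \<sigma>) (length \<tau>)"
  have parts: "is_partition \<sigma>" "is_partition \<tau>" using assms(4,5) by (auto simp: is_core_def)
  have "\<exists>p n0. degree p = (s - 1) * (t - 1) \<and> lead_coeff p = ?V \<and>
      (\<forall>n\<ge>n0. real (N_count s t \<sigma> \<tau> (i + n * (s * t))) = poly p (real n))" for i
  proof -
    \<comment> \<open>A base length in the class of \<open>i\<close> that accommodates both cores.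
      The margins \<open>a\<close> and \<open>b\<close> are extrapolated back by \<open>L\<close>
      periods, possibly to negative values, so that the polynomial variable is the quotient
      \<open>n\<close> itself.\<close>
    define k where "k = i + L * (s * t)"
    have "L * 1 \<le> L * (s * t)" using st by (intro mult_left_mono) auto
    then have k: "length \<sigma> \<le> k" "length \<tau> \<le> k" by (auto simp: k_def L_def)
    have shapes: "shape k (row_length \<sigma>)" "shape k (row_length \<tau>)"
      using parts k by (auto intro: shape_row_length)
    define a where "a r = int (runner_count t (beta k (row_length \<tau>)) r) - int L * int s" for r
    define b where "b r = int (runner_count s (beta k (row_length \<sigma>)) r) - int L * int t" for r
    have "(\<Sum>r<t. int (runner_count t (beta k (row_length \<tau>)) r)) = int k"
      using sum_runner_count[OF finite_beta st(2)] card_beta[OF shapes(2)] by (simp flip: of_nat_sum)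
    moreover have "(\<Sum>r<s. int (runner_count s (beta k (row_length \<sigma>)) r)) = int k"
      using sum_runner_count[OF finite_beta st(1)] card_beta[OF shapes(1)] by (simp flip: of_nat_sum)
    ultimately have ab: "(\<Sum>r<t. a r) = (\<Sum>r<s. b r)"
      by (simp add: a_def b_def sum_subtractf)
    obtain p n0 where p: "degree p = (s - 1) * (t - 1)" "lead_coeff p = ?V"
      and n0: "\<And>n. n \<ge> n0 \<Longrightarrow> real (card (tables t s ({..<t} \<times> {..<s})
        (\<lambda>i. a i + int n * int s) (\<lambda>j. b j + int n * int t))) = poly p (real n)"
      using card_tables_polynomial[OF st ab] unfolding eventually_sequentially by blast
    have "real (N_count s t \<sigma> \<tau> (i + n * (s * t))) = poly p (real n)" if n: "n \<ge> max n0 L" for n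
    proof -
      define m where "m = n - L"
      have nm: "n = L + m" using n by (simp add: m_def)
      have k1: "i + n * (s * t) = k + (m * s) * t" and k2: "i + n * (s * t) = k + (m * t) * s"
        by (simp_all add: nm k_def algebra_simps)
      have "N_count s t \<sigma> \<tau> (i + n * (s * t)) = card (tables t s ({..<t} \<times> {..<s})
          (\<lambda>r. int (runner_count t (beta (i + n * (s * t)) (row_length \<tau>)) r))
          (\<lambda>r. int (runner_count s (beta (i + n * (s * t)) (row_length \<sigma>)) r)))"
        using k k1 by (intro N_count_eq_card_tables[OF st assms(4) _ assms(5)]) auto
      also have "\<dots> = card (tables t s ({..<t} \<times> {..<s}) (\<lambda>i. a i + int n * int s) (\<lambda>j. b j + int n * int t))"
      proof (rule arg_cong[where f = card], rule tables_cong)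
        fix r assume r: "r < t"
        show "int (runner_count t (beta (i + n * (s * t)) (row_length \<tau>)) r) = a r + int n * int s"
          unfolding k1 runner_count_beta_shift[OF shapes(2) r] by (simp add: a_def nm algebra_simps)
      next
        fix r assume r: "r < s"
        show "int (runner_count s (beta (i + n * (s * t)) (row_length \<sigma>)) r) = b r + int n * int t"
          unfolding k2 runner_count_beta_shift[OF shapes(1) r] by (simp add: b_def nm algebra_simps)
      qed
      finally show ?thesis using n0[of n] n by simp
    qed
    then show ?thesis using p by blast
  qed
  then obtain P n0 where P: "\<And>i. degree (P i) = (s - 1) * (t - 1)" "\<And>i. lead_coeff (P i) = ?V"
    and n0: "\<And>i n. n \<ge> n0 i \<Longrightarrow> real (N_count s t \<sigma> \<tau> (i + n * (s * t))) = poly (P i) (real n)"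
    by metis
  \<comment> \<open>From here on the quotient of \<open>k\<close> by the period exceeds or equals
    the threshold of every residue class.\<close>
  define K where "K = (\<Sum>i<s * t. n0 i) * (s * t)"
  have "real (N_count s t \<sigma> \<tau> k) = poly (P (k mod (s * t))) (real (k div (s * t)))" if "k \<ge> K" for k
  proof -
    have pos: "0 < s * t" using st by simp
    then have "n0 (k mod (s * t)) \<le> (\<Sum>i<s * t. n0 i)" by (intro member_le_sum) auto
    also have "\<dots> \<le> k div (s * t)" using that pos by (simp add: K_def less_eq_div_iff_mult_less_eq)
    finally show ?thesis using n0 by (metis add.commute div_mult_mod_eq)
  qed
  moreover have "0 < ?V"
    by (rule card_tables_tendsto_rel_volume(2)[OF st(1,2), of "\<lambda>_. 0" "\<lambda>_. 0"]) simp
  ultimately show ?thesis using P by blast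
qed

end
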